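(* Let $\check R(z)$ be the normalized $R$-matrix of the $3$-dimensional first fundamental representation $\tilde L_1$ of $U_q(\mathrm A_2^{(2)})$, regarded as an operator on $\tilde L_1\otimes\tilde L_1$, where $\tilde L_1\cong L_{2\omega_1}$ as a $U_{q^{1/2}}(\mathrm A_1)$-module. In terms of projectors, $$\check{R}(z)=P_{4\omega_1}^q-q^{-2}\frac{1-q^{2}z}{1-q^{-2}z}P_{2\omega_1}^q+q^{-3}\frac{1+q^{3}z}{1+q^{-3}z}P_{\omega_0}^q .$$ In terms of matrix units, $$\check{R}(z)=\big(\check{R}(z)\big)_{\mathfrak{sl}_3}+\frac{(q-q^{-1})(1-z)}{(q-q^{-1}z)(q^{3/2}+q^{-3/2}z)}Q(z),$$ where $$\big(\check R(z)\big)_{\mathfrak{sl}_{3}}=\sum_{i=1}^{3} E_{ii}\otimes E_{ii}+\frac{z(q-q^{-1})}{q-q^{-1}z}\sum_{i<j}E_{ii}\otimes E_{jj}+\frac{q-q^{-1}}{q-q^{-1}z}\sum_{i>j}E_{ii}\otimes E_{jj}+\frac{1-z}{q-q^{-1}z}\sum_{i\ne j}E_{ij}\otimes E_{ji},$$ $$Q(z)=z\sum_{i+j<4}\frac{\varepsilon_i^q\varepsilon_j^q}{q^{3/2}}E_{ij}\otimes E_{\bar i\,\bar j}-\sum_{i+j>4}\frac{\varepsilon_i^q\varepsilon_j^q}{q^{-3/2}}E_{ij}\otimes E_{\bar i\,\bar j}-\frac{q-q^{-1}z}{q^{1/2}+q^{-1/2}}\sum_{i+j=4,\,i\ne 2}E_{ij}\otimes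 E_{\bar i\,\bar j}-\frac{q^2-q^{-2}z}{q^{1/2}+q^{-1/2}}E_{22}\otimes E_{22},$$ with all indices running over $1,2,3$, $\bar i=4-i$, and $\varepsilon_1^q=q^{1/2}$, $\varepsilon_2^q=-1$, $\varepsilon_3^q=q^{-1/2}$.
   Context: Fix $q\in\mathbb C^\times$, not a root of unity, and a square root $q^{1/2}$. $[2]_{1/2}=q^{1/2}+q^{-1/2}$. Algebra. $U_q(\mathrm A_2^{(2)})$ (level zero) is generated by $E_i,F_i,K_i^{\pm1}$, $i=0,1$, with $d_0=2$, $d_1=\frac12$, $q_i=q^{d_i}$, symmetrized Cartan matrix $B_{00}=4$, $B_{01}=B_{10}=-2$, $B_{11}=1$, Cartan matrix $C_{ij}=B_{ij}/d_i$. Relations: the $K_i$ are invertible and commute, $K_0K_1^2=1$, $K_iE_jK_i^{-1}=q^{B_{ij}}E_j$, $K_iF_jK_i^{-1}=q^{-B_{ij}}F_j$, $[E_i,F_j]=\delta_{ij}\frac{K_i-K_i^{-1}}{q_i-q_i^{-1}}$, and the quantum Serre relations. Coproduct: $\Delta K_i=K_i\otimes K_i$, $\Delta E_i=E_i\otimes K_i^{1/2}+K_i^{-1/2}\otimes E_i$, $\Delta F_i=F_i\otimes K_i^{1/2}+K_i^{-1/2}\otimes F_i$, where $K_i^{\pm1/2}$ acts by $q_i^{\pm\lambda_i/2}$ on a vector on which $K_i$ acts by $q_i^{\lambda_i}$. The subalgebra generated by $E_1,F_1,K_1^{\pm1}$ is $U_{q^{1/2}}(\mathrm A_1)$; $L_{k\omega_1}$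 is its irreducible (type 1) module of dimension $k+1$, and $\omega_0=0$. First fundamental module. $\tilde L_1(a)$, $a\in\mathbb C^\times$, has basis $v_1,v_2,v_3$ with $F_1v_i=\sqrt{[2]_{1/2}}\,v_{i+1}$, $i=1,2$, $F_1v_3=0$, $E_1$ the transpose of $F_1$, $K_1v_1=qv_1$, $K_1v_2=v_2$, $K_1v_3=q^{-1}v_3$. $E_{ij}$ are the matrix units, $E_{ij}v_k=\delta_{jk}v_i$. Further, $K_0=q^{-2}E_{11}+E_{22}+q^2E_{33}$, $E_0(a)=aE_{31}$, and $F_0(a)$ is the transpose of $a^{-2}E_0(a)$. (In terms of Drinfeld polynomials this is the first fundamental module, up to an overall rescaling of $a$ that does not affect $\check R$.) $R$-matrix. $\check R(z)$ is the rational $\mathrm{End}(\tilde L_1\otimes\tilde L_1)$-valued function of $z$ (the flip composed with the universal $R$-matrix evaluated on $\tilde L_1(z)\otimes\tilde L_1(1)$, normalized) such that for generic $a/b$ the map $\check R(a/b):\tilde L_1(a)\otimes\tilde L_1(b)\to\tilde L_1(b)\otimes\tilde L_1(a)$ is the unique module homomorphism with $v_1\otimes v_1\mapsto v_1\otimes v_1$. Projectors. As $U_{q^{1/2}}(\mathrm A_1)$-modules, $L_{2\omega_1}\otimes L_{2\omega_1}\cong L_{4\omega_1}\oplus L_{2\omega_1}\oplus L_{\omega_0}$, and $P^q_\lambda$ is the projector onto $L_\lambda$ along the other summands. *)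

theory Defs
  imports "HOL-Analysis.Analysis" "HOL-Computational_Algebra.Polynomial"
begin

section \<open>Matrices and tensor products\<close>

text \<open>A linear operator on \<open>complex^'n\<close> is identified with its matrix, acting on column vectors
  by \<open>*v\<close>. The space \<open>complex^('m \<times> 'n)\<close> is the tensor product of \<open>complex^'m\<close> and \<open>complex^'n\<close>.\<close>

definition msmult :: "complex \<Rightarrow> complex^'n^'m \<Rightarrow> complex^'n^'m"  (infixl \<open>\<odot>\<close> 70)
  where "c \<odot> A = map_matrix ((*) c) A"

definition kron :: "complex^'m^'m \<Rightarrow> complex^'n^'n \<Rightarrow> complex^('m \<times> 'n)^('m \<times> 'n)"
    (infixl \<open>\<otimes>\<close> 75)
  where "A \<otimes> B = (\<chi> i j. A $ fst i $ fst j * B $ snd i $ snd j)"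

definition vtensor :: "complex^'m \<Rightarrow> complex^'n \<Rightarrow> complex^('m \<times> 'n)"
  where "vtensor x y = (\<chi> i. x $ fst i * y $ snd i)"

definition mpow :: "complex^'n^'n \<Rightarrow> nat \<Rightarrow> complex^'n^'n"
  where "mpow A n = (((**) A) ^^ n) (mat 1)"

text \<open>The basis vectors and matrix units of \<open>complex^3\<close> are indexed by the natural numbers
  \<open>1, 2, 3\<close>. The order on the type \<open>3\<close> must not be used for conditions such as \<open>i < j\<close>,
  because \<open>3 = 0\<close> in that type.\<close>

definition bv :: "nat \<Rightarrow> complex^3"
  where "bv i = axis (of_nat i) 1"

definition E :: "nat \<Rightarrow> nat \<Rightarrow> complex^3^3"
  where "E i j = (\<chi> k l. if k = of_nat i \<and> l = of_nat j then 1 else 0)"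

section \<open>The quantum affine algebra and its modules\<close>

text \<open>Throughout, \<open>s\<close> stands for the chosen square root of \<open>q\<close>, so that \<open>q\<^sub>0 = q\<^sup>2\<close> and
  \<open>q\<^sub>1 = s\<close>. The nodes are \<open>0\<close> and \<open>1\<close>.\<close>

definition qnode :: "complex \<Rightarrow> complex \<Rightarrow> nat \<Rightarrow> complex"
  where "qnode q s i = (if i = 0 then q ^ 2 else s)"

definition symB :: "nat \<Rightarrow> nat \<Rightarrow> int"
  where "symB i j = (if i \<noteq> j then -2 else if i = 0 then 4 else 1)"

text \<open>The Cartan matrix \<open>symB i j / d\<^sub>i\<close> with \<open>d\<^sub>0 = 2\<close> and \<open>d\<^sub>1 = 1/2\<close>.\<close>

definition cartan :: "nat \<Rightarrow> nat \<Rightarrow> int"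
  where "cartan i j = (if i = j then 2 else if i = 0 then -1 else -4)"

definition qint :: "complex \<Rightarrow> nat \<Rightarrow> complex"
  where "qint p n = (p ^ n - inverse p ^ n) / (p - inverse p)"

definition qfact :: "complex \<Rightarrow> nat \<Rightarrow> complex"
  where "qfact p n = (\<Prod>k=1..n. qint p k)"

definition qbinom :: "complex \<Rightarrow> nat \<Rightarrow> nat \<Rightarrow> complex"
  where "qbinom p n k = qfact p n / (qfact p k * qfact p (n - k))"

text \<open>The matrices by which the generators \<open>E\<^sub>i\<close>, \<open>F\<^sub>i\<close>, \<open>K\<^sub>i\<close> act; \<open>K\<^sub>i\<^sup>-\<^sup>1\<close> acts by the inverse
  matrix.\<close>

record ('n::finite) gens =
  gE :: "nat \<Rightarrow> complex^'n^'n"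
  gF :: "nat \<Rightarrow> complex^'n^'n"
  gK :: "nat \<Rightarrow> complex^'n^'n"

definition qserre :: "complex \<Rightarrow> complex \<Rightarrow> (nat \<Rightarrow> complex^'n^'n) \<Rightarrow> nat \<Rightarrow> nat \<Rightarrow> bool"
  where "qserre q s X i j \<longleftrightarrow>
    (let n = nat (1 - cartan i j) in
      (\<Sum>k=0..n. ((-1) ^ k * qbinom (qnode q s i) n k) \<odot>
         (mpow (X i) (n - k) ** X j ** mpow (X i) k)) = 0)"

definition uq_module :: "complex \<Rightarrow> complex \<Rightarrow> 'n::finite gens \<Rightarrow> bool"
  where "uq_module q s M \<longleftrightarrow>
    (\<forall>i\<in>{0,1}. invertible (gK M i)) \<and>
    gK M 0 ** gK M 1 = gK M 1 ** gK M 0 \<and>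
    gK M 0 ** mpow (gK M 1) 2 = mat 1 \<and>
    (\<forall>i\<in>{0,1}. \<forall>j\<in>{0,1}.
       gK M i ** gE M j ** matrix_inv (gK M i) = (q powi symB i j) \<odot> gE M j \<and>
       gK M i ** gF M j ** matrix_inv (gK M i) = (q powi (- symB i j)) \<odot> gF M j \<and>
       gE M i ** gF M j - gF M j ** gE M i =
         (if i = j then (1 / (qnode q s i - inverse (qnode q s i))) \<odot>
                          (gK M i - matrix_inv (gK M i))
          else 0)) \<and>
    (\<forall>i\<in>{0,1}. \<forall>j\<in>{0,1}. i \<noteq> j \<longrightarrow> qserre q s (gE M) i j \<and> qserre q s (gF M) i j)"

text \<open>Commuting with \<open>K\<^sub>i\<close> implies commuting with its inverse.\<close>

definition uq_hom :: "'m::finite gens \<Rightarrow> 'n::finite gens \<Rightarrow> complex^'m^'n \<Rightarrow> bool"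
  where "uq_hom M N T \<longleftrightarrow>
    (\<forall>i\<in>{0,1}. T ** gE M i = gE N i ** T \<and> T ** gF M i = gF N i ** T \<and>
                T ** gK M i = gK N i ** T)"

text \<open>The number \<open>q\<^sub>i\<close> to the power \<open>m/2\<close>. For \<open>i = 1\<close> this is used for even \<open>m\<close> only: the weights of
  \<open>K\<^sub>1\<close> on the modules considered here are even, so no square root of \<open>s\<close> has to be chosen.\<close>

definition qhalf :: "complex \<Rightarrow> complex \<Rightarrow> nat \<Rightarrow> int \<Rightarrow> complex"
  where "qhalf q s i m = (if i = 0 then q powi m else s powi (m div 2))"

text \<open>For \<open>e = 1\<close> and \<open>e = -1\<close> this is the operator \<open>K\<^sub>i\<close> to the power \<open>e/2\<close>, where \<open>K\<close> is the
  operator \<open>K\<^sub>i\<close>.\<close>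

definition Khalf :: "complex \<Rightarrow> complex \<Rightarrow> nat \<Rightarrow> int \<Rightarrow> complex^'n^'n \<Rightarrow> complex^'n^'n"
  where "Khalf q s i e K =
    (THE H. \<forall>m v. (i = 1 \<longrightarrow> even m) \<longrightarrow> K *v v = (qnode q s i powi m) *s v \<longrightarrow>
              H *v v = qhalf q s i (e * m) *s v)"

definition tensor :: "complex \<Rightarrow> complex \<Rightarrow> 'm::finite gens \<Rightarrow> 'n::finite gens \<Rightarrow> ('m \<times> 'n) gens"
  where "tensor q s M N =
    \<lparr> gE = (\<lambda>i. gE M i \<otimes> Khalf q s i 1 (gK N i) + Khalf q s i (-1) (gK M i) \<otimes> gE N i),
      gF = (\<lambda>i. gF M i \<otimes> Khalf q s i 1 (gK N i) + Khalf q s i (-1) (gK M i) \<otimes> gF N i),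
      gK = (\<lambda>i. gK M i \<otimes> gK N i) \<rparr>"

text \<open>The first fundamental module with parameter \<open>a\<close>; \<open>r\<close> is the chosen square root of
  \<open>s + s\<^sup>-\<^sup>1\<close>.\<close>

definition L1 :: "complex \<Rightarrow> complex \<Rightarrow> complex \<Rightarrow> 3 gens"
  where "L1 q r a =
    \<lparr> gE = (\<lambda>i. if i = 0 then a \<odot> E 3 1 else transpose (r \<odot> (E 2 1 + E 3 2))),
      gF = (\<lambda>i. if i = 0 then transpose (inverse a ^ 2 \<odot> (a \<odot> E 3 1)) else r \<odot> (E 2 1 + E 3 2)),
      gK = (\<lambda>i. if i = 0 then q powi (-2) \<odot> E 1 1 + E 2 2 + q ^ 2 \<odot> E 3 3
                 else q \<odot> E 1 1 + E 2 2 + inverse q \<odot> E 3 3) \<rparr>"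

section \<open>The normalized R-matrix\<close>

text \<open>An operator-valued rational function, written as a polynomial matrix over a common
  denominator none of whose zeros can be cancelled. Thus the zeros of \<open>d\<close> are exactly the poles; the
  value of \<open>R\<close> at a pole is irrelevant.\<close>

definition rational_op :: "(complex \<Rightarrow> complex^'n^'n) \<Rightarrow> bool"
  where "rational_op R \<longleftrightarrow>
    (\<exists>(N :: complex poly^'n^'n) d. d \<noteq> 0 \<and>
       (\<forall>z. poly d z = 0 \<longrightarrow> (\<exists>i j. poly (N $ i $ j) z \<noteq> 0)) \<and>
       (\<forall>z. poly d z \<noteq> 0 \<longrightarrow> R z = (\<chi> i j. poly (N $ i $ j) z / poly d z)))"

text \<open>``Generic'' means that \<open>a / b\<close> avoids a finite set.\<close>

definition normalized_R ::
    "complex \<Rightarrow> complex \<Rightarrow> complex \<Rightarrow> (complex \<Rightarrow> complex^(3 \<times> 3)^(3 \<times> 3)) \<Rightarrow> bool"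
  where "normalized_R q s r R \<longleftrightarrow>
    rational_op R \<and>
    (\<exists>S. finite S \<and>
      (\<forall>a b. a \<noteq> 0 \<longrightarrow> b \<noteq> 0 \<longrightarrow> a / b \<notin> S \<longrightarrow>
        (\<forall>T. uq_hom (tensor q s (L1 q r a) (L1 q r b)) (tensor q s (L1 q r b) (L1 q r a)) T \<and>
              T *v vtensor (bv 1) (bv 1) = vtensor (bv 1) (bv 1)
            \<longleftrightarrow> T = R (a / b))))"

section \<open>Projectors\<close>

definition A1_invariant :: "'n::finite gens \<Rightarrow> (complex^'n) set \<Rightarrow> bool"
  where "A1_invariant M W \<longleftrightarrow>
    vec.subspace W \<and> (\<forall>w\<in>W. gE M 1 *v w \<in> W \<and> gF M 1 *v w \<in> W \<and> gK M 1 *v w \<in> W)"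

text \<open>\<open>W\<close> is a submodule over the subalgebra generated by \<open>E\<^sub>1\<close>, \<open>F\<^sub>1\<close>, \<open>K\<^sub>1\<close> and is isomorphic to the
  irreducible module of type 1 and dimension \<open>k + 1\<close>. Type 1 means that \<open>K\<^sub>1\<close> is diagonalizable with
  integer powers of \<open>q\<^sub>1 = s\<close> as eigenvalues.\<close>

definition A1_irreducible :: "complex \<Rightarrow> 'n::finite gens \<Rightarrow> nat \<Rightarrow> (complex^'n) set \<Rightarrow> bool"
  where "A1_irreducible s M k W \<longleftrightarrow>
    A1_invariant M W \<and> vec.dim W = k + 1 \<and>
    (\<forall>U\<subseteq>W. A1_invariant M U \<longrightarrow> U = {0} \<or> U = W) \<and>
    W \<subseteq> vec.span {w\<in>W. \<exists>m::int. gK M 1 *v w = (s powi m) *s w}"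

text \<open>\<open>Pq q s r k\<close> is the projector onto the summand of highest weight \<open>k\<close> times the fundamental
  weight. The action of node \<open>1\<close> does not involve the parameters of the two tensor factors, so both
  are set to \<open>1\<close>.\<close>

definition Pq :: "complex \<Rightarrow> complex \<Rightarrow> complex \<Rightarrow> nat \<Rightarrow> complex^(3 \<times> 3)^(3 \<times> 3)"
  where "Pq q s r k =
    (THE P. \<exists>W. (\<forall>j\<in>{0,2,4}. A1_irreducible s (tensor q s (L1 q r 1) (L1 q r 1)) j (W j)) \<and>
       (\<forall>v. \<exists>!w. w \<in> (\<Pi>\<^sub>E j\<in>{0,2,4::nat}. W j) \<and> v = (\<Sum>j\<in>{0,2,4}. w j)) \<and>
       (\<forall>j\<in>{0,2,4}. \<forall>w\<in>W j. P *v w = (if j = k then w else 0)))"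

section \<open>The expression in matrix units\<close>

definition idx :: "(nat \<times> nat) set"
  where "idx = {1..3} \<times> {1..3}"

definition eps :: "complex \<Rightarrow> nat \<Rightarrow> complex"
  where "eps s i = (if i = 1 then s else if i = 2 then -1 else inverse s)"

definition R_sl3 :: "complex \<Rightarrow> complex \<Rightarrow> complex^(3 \<times> 3)^(3 \<times> 3)"
  where "R_sl3 q z =
    (\<Sum>i=1..3. E i i \<otimes> E i i)
    + (z * (q - inverse q) / (q - inverse q * z)) \<odot> (\<Sum>(i,j)\<in>{(i,j)\<in>idx. i < j}. E i i \<otimes> E j j)
    + ((q - inverse q) / (q - inverse q * z)) \<odot> (\<Sum>(i,j)\<in>{(i,j)\<in>idx. i > j}. E i i \<otimes> E j j)
    + ((1 - z) / (q - inverse q * z)) \<odot> (\<Sum>(i,j)\<in>{(i,j)\<in>idx. i \<noteq> j}. E i j \<otimes> E j i)"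

definition Qmat :: "complex \<Rightarrow> complex \<Rightarrow> complex \<Rightarrow> complex^(3 \<times> 3)^(3 \<times> 3)"
  where "Qmat q s z =
    z \<odot> (\<Sum>(i,j)\<in>{(i,j)\<in>idx. i + j < 4}.
            (eps s i * eps s j / s ^ 3) \<odot> (E i j \<otimes> E (4 - i) (4 - j)))
    - (\<Sum>(i,j)\<in>{(i,j)\<in>idx. i + j > 4}.
            (eps s i * eps s j / s powi (-3)) \<odot> (E i j \<otimes> E (4 - i) (4 - j)))
    - ((q - inverse q * z) / (s + inverse s)) \<odot>
        (\<Sum>(i,j)\<in>{(i,j)\<in>idx. i + j = 4 \<and> i \<noteq> 2}. E i j \<otimes> E (4 - i) (4 - j))
    - ((q ^ 2 - q powi (-2) * z) / (s + inverse s)) \<odot> (E 2 2 \<otimes> E 2 2)"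

section \<open>The first fundamental module satisfies the defining relations\<close>

text \<open>The facts proved here confirm that \<open>L1\<close> is a module of the quantum affine algebra, quantum
  Serre relations included, that \<open>Khalf\<close> determines the expected diagonal operators on it, and that
  under node \<open>1\<close> it is the irreducible module of highest weight \<open>2\<close>.\<close>

lemma matrix_inv_eqI:
  fixes A B :: "complex^'n^'n"
  assumes "A ** B = mat 1" "B ** A = mat 1"
  shows "matrix_inv A = B" and "invertible A"
proof -
  show "invertible A" using assms unfolding invertible_def by blast
  have "A ** matrix_inv A = mat 1 \<and> matrix_inv A ** A = mat 1"
    unfolding matrix_inv_def by (rule someI[of _ B]) (use assms in simp)
  then show "matrix_inv A = B"
    by (metis assms(2) matrix_mul_assoc matrix_mul_lid matrix_mul_rid)
qed

lemmas mat3_simps = vec_eq_iff forall_3 sum_3 matrix_matrix_mult_def matrix_vector_mult_def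
  msmult_def E_def transpose_def mat_def map_matrix_def

lemma gens_L1_simps:
  "gE (L1 q r a) 0 = a \<odot> E 3 1" "gE (L1 q r a) 1 = r \<odot> (E 1 2 + E 2 3)"
  "gE (L1 q r a) (Suc 0) = r \<odot> (E 1 2 + E 2 3)"
  "a \<noteq> 0 \<Longrightarrow> gF (L1 q r a) 0 = inverse a \<odot> E 1 3" "gF (L1 q r a) 1 = r \<odot> (E 2 1 + E 3 2)"
  "gF (L1 q r a) (Suc 0) = r \<odot> (E 2 1 + E 3 2)"
  "gK (L1 q r a) 0 = q powi (-2) \<odot> E 1 1 + E 2 2 + q ^ 2 \<odot> E 3 3"
  "gK (L1 q r a) 1 = q \<odot> E 1 1 + E 2 2 + inverse q \<odot> E 3 3"
  "gK (L1 q r a) (Suc 0) = q \<odot> E 1 1 + E 2 2 + inverse q \<odot> E 3 3"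
  by (auto simp: L1_def mat3_simps power2_eq_square)

lemma L1_K_inv:
  assumes "q \<noteq> 0"
  shows "matrix_inv (gK (L1 q r a) 0) = q ^ 2 \<odot> E 1 1 + E 2 2 + q powi (-2) \<odot> E 3 3" (is ?A)
    "matrix_inv (gK (L1 q r a) 1) = inverse q \<odot> E 1 1 + E 2 2 + q \<odot> E 3 3" (is ?B)
    "invertible (gK (L1 q r a) 0)" "invertible (gK (L1 q r a) 1)"
proof -
  have 1: "gK (L1 q r a) 0 ** (q ^ 2 \<odot> E 1 1 + E 2 2 + q powi (-2) \<odot> E 3 3) = mat 1"
    "(q ^ 2 \<odot> E 1 1 + E 2 2 + q powi (-2) \<odot> E 3 3) ** gK (L1 q r a) 0 = mat 1"
    using assms by (simp_all add: gens_L1_simps mat3_simps power_int_minus)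
  have 2: "gK (L1 q r a) 1 ** (inverse q \<odot> E 1 1 + E 2 2 + q \<odot> E 3 3) = mat 1"
    "(inverse q \<odot> E 1 1 + E 2 2 + q \<odot> E 3 3) ** gK (L1 q r a) 1 = mat 1"
    using assms by (simp_all add: gens_L1_simps mat3_simps)
  show ?A ?B "invertible (gK (L1 q r a) 0)" "invertible (gK (L1 q r a) 1)"
    using matrix_inv_eqI[OF 1] matrix_inv_eqI[OF 2] by auto
qed

lemma uq_module_L1:
  assumes q: "q \<noteq> 0" "\<forall>n>0. q ^ n \<noteq> 1" and s: "s ^ 2 = q" and r: "r ^ 2 = s + inverse s"
    and a: "a \<noteq> 0"
  shows "uq_module q s (L1 q r a)"
proof -
  have s0: "s \<noteq> 0" using q s by auto
  have q2: "q ^ 2 \<noteq> 1" and q4: "q ^ 4 \<noteq> 1" and q1: "q \<noteq> 1" using q(2) by (auto dest: spec[of _ 1])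
  have s1: "s - inverse s \<noteq> 0"
    using s0 q1 s by (auto simp: field_simps power2_eq_square)
  have d0: "q ^ 2 - inverse (q ^ 2) \<noteq> 0"
    using q(1) q4 by (auto simp: field_simps power2_eq_square power4_eq_xxxx)
  have rr: "r * r = (q - inverse q) / (s - inverse s)"
    using r s s0 s1 by (auto simp: field_simps power2_eq_square)
  have K: "gK (L1 q r a) 0 ** gK (L1 q r a) 1 = gK (L1 q r a) 1 ** gK (L1 q r a) 0"
     "gK (L1 q r a) 0 ** mpow (gK (L1 q r a) 1) 2 = mat 1"
    using q(1) by (simp_all add: gens_L1_simps mpow_def mat3_simps power_int_minus power2_eq_square numeral_2_eq_2 field_simps)
  have C: "\<forall>i\<in>{0,1}. \<forall>j\<in>{0,1}.
       gK (L1 q r a) i ** gE (L1 q r a) j ** matrix_inv (gK (L1 q r a) i) = (q powi symB i j) \<odot> gE (L1 q r a) j \<and>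
       gK (L1 q r a) i ** gF (L1 q r a) j ** matrix_inv (gK (L1 q r a) i) = (q powi (- symB i j)) \<odot> gF (L1 q r a) j"
    using q(1) a by (simp add: L1_K_inv L1_K_inv[simplified] symB_def, simp add: gens_L1_simps, simp add: mat3_simps power_int_minus power2_eq_square power4_eq_xxxx field_simps)
  have B: "\<forall>i\<in>{0,1}. \<forall>j\<in>{0,1}. gE (L1 q r a) i ** gF (L1 q r a) j - gF (L1 q r a) j ** gE (L1 q r a) i =
         (if i = j then (1 / (qnode q s i - inverse (qnode q s i))) \<odot>
                          (gK (L1 q r a) i - matrix_inv (gK (L1 q r a) i))
          else 0)"
    using q(1) a d0 s1 by (simp add: L1_K_inv L1_K_inv[simplified] qnode_def, simp add: gens_L1_simps, simp add: mat3_simps power_int_minus rr divide_simps)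
  have S: "\<forall>i\<in>{0,1}. \<forall>j\<in>{0,1}. i \<noteq> j \<longrightarrow> qserre q s (gE (L1 q r a)) i j \<and> qserre q s (gF (L1 q r a)) i j"
    using a by (simp add: qserre_def cartan_def gens_L1_simps mpow_def numeral_eq_Suc, simp add: mat3_simps)
  show ?thesis unfolding uq_module_def using L1_K_inv[OF q(1)] K C B S by auto
qed
lemma powi_inj:
  assumes "x \<noteq> (0::complex)" "\<forall>n>0. x ^ n \<noteq> 1" "x powi m = x powi n"
  shows "m = n"
proof (rule ccontr)
  assume mn: "m \<noteq> n"
  have 1: "x powi (m - n) = 1" "x powi (n - m) = 1"
    using assms by (simp_all add: power_int_diff)
  show False
  proof (cases "m > n")
    case True
    then have "x ^ nat (m - n) = 1" using 1 by (simp add: power_int_def)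
    then show False using True assms(2) by auto
  next
    case False
    then have "x ^ nat (n - m) = 1" using 1 by (simp add: power_int_def)
    then show False using mn False assms(2) by auto
  qed
qed

lemma diag_eigen:
  "(x \<odot> E 1 1 + y \<odot> E 2 2 + z \<odot> E 3 3) *v v = c *s v \<longleftrightarrow>
    (v $ 1 = 0 \<or> x = c) \<and> (v $ 2 = 0 \<or> y = c) \<and> (v $ 3 = 0 \<or> z = c)"
  by (auto simp: mat3_simps)

lemma Khalf_diag:
  fixes w1 w2 w3 e :: int and i :: nat and q s :: complex
  defines "p \<equiv> \<lambda>m. qnode q s i powi m" and "h \<equiv> \<lambda>m. qhalf q s i (e * m)"
  assumes i: "i = 1 \<longrightarrow> even w1 \<and> even w2 \<and> even w3"
    and p: "qnode q s i \<noteq> 0" "\<forall>n>0. qnode q s i ^ n \<noteq> 1"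
  shows "Khalf q s i e (p w1 \<odot> E 1 1 + p w2 \<odot> E 2 2 + p w3 \<odot> E 3 3) =
    h w1 \<odot> E 1 1 + h w2 \<odot> E 2 2 + h w3 \<odot> E 3 3" (is "Khalf q s i e ?K = ?H")
  unfolding Khalf_def
proof (rule the_equality, intro allI impI)
  fix m v assume m: "i = 1 \<longrightarrow> even m" and v: "?K *v v = (qnode q s i powi m) *s v"
  have inj: "p a = qnode q s i powi m \<Longrightarrow> a = m" for a
    unfolding p_def using powi_inj[OF p] by blast
  show "?H *v v = qhalf q s i (e * m) *s v"
    using v inj unfolding diag_eigen by (auto simp: h_def)
next
  fix H assume H: "\<forall>m v. (i = 1 \<longrightarrow> even m) \<longrightarrow> ?K *v v = (qnode q s i powi m) *s v \<longrightarrow>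
              H *v v = qhalf q s i (e * m) *s v"
  have 1: "H *v axis 1 1 = h w1 *s axis 1 1" and 2: "H *v axis 2 1 = h w2 *s axis 2 1"
    and 3: "H *v axis 3 1 = h w3 *s axis 3 1"
    unfolding h_def using i by (auto intro!: H[rule_format] simp: diag_eigen[simplified] p_def axis_def)
  show "H = ?H"
    using 1 2 3 by (simp add: mat3_simps axis_def)
qed

lemma Khalf_L1:
  assumes q: "q \<noteq> 0" "\<forall>n>0. q ^ n \<noteq> 1" and s: "s ^ 2 = q"
  shows "Khalf q s 0 e (gK (L1 q r a) 0) = (q powi (-e)) \<odot> E 1 1 + E 2 2 + (q powi e) \<odot> E 3 3"
    and "Khalf q s 1 e (gK (L1 q r a) 1) = (s powi e) \<odot> E 1 1 + E 2 2 + (s powi (-e)) \<odot> E 3 3"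
proof -
  have one: "1 \<odot> E 2 2 = E 2 2" by (simp add: mat3_simps)
  have s0: "s \<noteq> 0" using q s by auto
  have half: "- (e * 2) div 2 = - e" by presburger
  have n0: "\<forall>n>0. (q ^ 2) ^ n \<noteq> 1" using q(2) by (simp flip: power_mult)
  have n1: "s ^ n \<noteq> 1" if "n > 0" for n
  proof
    assume "s ^ n = 1"
    then have "q ^ n = 1" unfolding s[symmetric] by (metis mult.commute power_mult power_one)
    then show False using q(2) that by blast
  qed
  have q0: "qnode q s 0 powi (-1) = q powi (-2)" "qnode q s 0 powi 1 = q ^ 2"
    by (simp_all add: qnode_def power_int_minus)
  have q1: "qnode q s 1 powi 2 = q" "qnode q s 1 powi (-2) = inverse q"
    using s by (simp_all add: qnode_def power_int_minus)
  show "Khalf q s 0 e (gK (L1 q r a) 0) = (q powi (-e)) \<odot> E 1 1 + E 2 2 + (q powi e) \<odot> E 3 3"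
    using Khalf_diag[of 0 "-1" 0 1 q s e] q(1) n0 unfolding q0
    by (simp add: gens_L1_simps one qhalf_def qnode_def)
  show "Khalf q s 1 e (gK (L1 q r a) 1) = (s powi e) \<odot> E 1 1 + E 2 2 + (s powi (-e)) \<odot> E 3 3"
    using Khalf_diag[of 1 2 0 "-2" q s e] s0 n1 unfolding q1
    by (simp add: gens_L1_simps one qhalf_def qnode_def half)
qed

lemma A1_irreducible_L1:
  assumes q: "q \<noteq> 0" "\<forall>n>0. q ^ n \<noteq> 1" and s: "s ^ 2 = q" and r: "r ^ 2 = s + inverse s"
  shows "A1_irreducible s (L1 q r a) 2 UNIV"
proof -
  have s0: "s \<noteq> 0" using q s by auto
  have "q ^ 2 \<noteq> 1" using q(2) by simp
  have r0: "r \<noteq> 0"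
  proof
    assume "r = 0"
    then have "s * (s + inverse s) = 0" using r by simp
    then have "q = -1" using s s0 by (simp add: distrib_left power2_eq_square add_eq_0_iff2)
    with \<open>q ^ 2 \<noteq> 1\<close> show False by simp
  qed
  have Eact: "gE (L1 q r a) 1 *v u = r *s (u $ 2 *s axis 1 1 + u $ 3 *s axis 2 1)" for u
    by (simp add: gens_L1_simps mat3_simps axis_def)
  have Fact: "gF (L1 q r a) 1 *v u = r *s (u $ 1 *s axis 2 1 + u $ 2 *s axis 3 1)" for u
    by (simp add: gens_L1_simps mat3_simps axis_def)
  have K: "gK (L1 q r a) 1 *v axis 1 1 = (s powi 2) *s axis 1 1"
     "gK (L1 q r a) 1 *v axis 2 1 = (s powi 0) *s axis 2 1"
     "gK (L1 q r a) 1 *v axis 3 1 = (s powi (-2)) *s axis 3 1"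
    using s by (simp_all add: gens_L1_simps mat3_simps axis_def power_int_minus)
  have decomp: "u = u $ 1 *s axis 1 1 + u $ 2 *s axis 2 1 + u $ 3 *s axis 3 1" for u :: "complex^3"
    by (simp add: mat3_simps axis_def)
  have irr: "U = UNIV" if U: "A1_invariant (L1 q r a) U" and "U \<noteq> {0}" for U
  proof -
    have sub: "vec.subspace U"
      and EU: "\<And>u. u \<in> U \<Longrightarrow> r *s (u $ 2 *s axis 1 1 + u $ 3 *s axis 2 1) \<in> U"
      and FU: "\<And>u. u \<in> U \<Longrightarrow> r *s (u $ 1 *s axis 2 1 + u $ 2 *s axis 3 1) \<in> U"
      using U unfolding A1_invariant_def Eact Fact by auto
    have cancel: "x \<in> U" if "c *s x \<in> U" "c \<noteq> 0" for c x
      using vec.subspace_scale[OF sub that(1), of "inverse c"] that(2) by simp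
    have EU': "u $ 2 *s axis 1 1 + u $ 3 *s axis 2 1 \<in> U" if "u \<in> U" for u
      using EU[OF that] r0 by (rule cancel)
    have FU': "u $ 1 *s axis 2 1 + u $ 2 *s axis 3 1 \<in> U" if "u \<in> U" for u
      using FU[OF that] r0 by (rule cancel)
    obtain u where u: "u \<in> U" "u \<noteq> 0"
      using \<open>U \<noteq> {0}\<close> vec.subspace_0[OF sub] by blast
    have a1: "axis 1 1 \<in> U"
    proof (cases "u $ 3 = 0")
      case False
      from EU'[OF EU'[OF u(1)]] have "u $ 3 *s axis 1 1 \<in> U" by (simp add: axis_def)
      then show ?thesis using False by (rule cancel)
    next
      case u3: True
      show ?thesis
      proof (cases "u $ 2 = 0")
        case False
        from EU'[OF u(1)] u3 have "u $ 2 *s axis 1 1 \<in> U" by simp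
        then show ?thesis using False by (rule cancel)
      next
        case True
        have "u $ 1 \<noteq> 0" using u(2) u3 True by (auto simp: vec_eq_iff forall_3)
        moreover have "u $ 1 *s axis 1 1 \<in> U" using u(1) decomp[of u] u3 True by simp
        ultimately show ?thesis using cancel by blast
      qed
    qed
    have a2: "axis 2 1 \<in> U" using FU'[OF a1] by (simp add: axis_def)
    have a3: "axis 3 1 \<in> U" using FU'[OF a2] by (simp add: axis_def)
    have "v \<in> U" for v
      by (subst decomp) (intro vec.subspace_add[OF sub] vec.subspace_scale[OF sub] a1 a2 a3)
    then show ?thesis by blast
  qed
  have span: "v \<in> vec.span {w\<in>UNIV. \<exists>m::int. gK (L1 q r a) 1 *v w = (s powi m) *s w}" for v
    by (subst decomp, intro vec.span_add vec.span_scale vec.span_base) (use K in blast)+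
  show ?thesis
    unfolding A1_irreducible_def
    using irr span by (auto simp: A1_invariant_def vec_dim_card card_cart_basis simp del: vec.dim_UNIV)
qed

end

theory Submission
  imports Defs
begin

text \<open>Under node \<open>1\<close> the tensor square of \<open>L1\<close> decomposes along three strings of weight vectors, one per
  summand, obtained from highest weight vectors by applying \<open>F\<^sub>1\<close>. In the standard basis \<open>E\<^sub>1\<close> is the
  transpose of \<open>F\<^sub>1\<close>, so the nine weight vectors are orthogonal for the standard bilinear form and
  yield explicit projectors. The operator given by matrix units is diagonal on these vectors, which is
  the projector formula and makes it commute with node \<open>1\<close>; commutation with \<open>E\<^sub>0\<close> is a finite
  computation, and commutation with \<open>F\<^sub>0\<close> follows by transposition, which replaces \<open>a\<close>, \<open>b\<close>
  by their inverses.

  An intertwiner is determined by its value on \<open>v\<^sub>1 \<otimes> v\<^sub>1\<close>, because this vector generates the module: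
  \<open>F\<^sub>1\<close> generates the top summand, and the components of \<open>E\<^sub>0 (v\<^sub>1 \<otimes> v\<^sub>1)\<close> in the two other summands are
  nonzero multiples of weight vectors unless \<open>a / b\<close> is \<open>q\<^sup>2\<close> or \<open>- q\<^sup>3\<close>. Finally, a rational function
  is determined off its poles by its values outside a finite set.\<close>

section \<open>Matrices, tensor products and transposition\<close>

lemma sum_UNIV_3x3:
  fixes f :: "3 \<times> 3 \<Rightarrow> 'a::comm_monoid_add"
  shows "sum f UNIV = (\<Sum>i\<in>UNIV. \<Sum>j\<in>UNIV. f (i, j))"
  by (simp add: sum.cartesian_product flip: UNIV_Times_UNIV)

lemma vec_eq_iff_3x3:
  fixes v w :: "complex^(3 \<times> 3)"
  shows "v = w \<longleftrightarrow> (\<forall>i j. v $ (i, j) = w $ (i, j))"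
  by (auto simp: vec_eq_iff)

lemma kron_mult_vec:
  fixes A B :: "complex^3^3"
  shows "((A \<otimes> B) *v v) $ (i, j) = (\<Sum>k\<in>UNIV. A $ i $ k * (\<Sum>l\<in>UNIV. B $ j $ l * v $ (k, l)))"
  by (simp add: kron_def matrix_vector_mult_def sum_UNIV_3x3 sum_distrib_left mult.assoc)

lemma msmult_mult_vec: "((c \<odot> A) *v v) = c *s (A *v v)"
  by (simp add: msmult_def map_matrix_def matrix_vector_mult_def vec_eq_iff sum_distrib_left mult.assoc)

lemma msmult_component: "(c \<odot> A) $ i $ j = c * A $ i $ j"
  by (simp add: msmult_def map_matrix_def)

lemma E_component: "E i j $ k $ l = (if k = of_nat i \<and> l = of_nat j then 1 else 0)"
  by (simp add: E_def)

lemma transpose_add: "transpose (A + B) = transpose A + transpose B" for A B :: "complex^'n^'n"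
  by (simp add: vec_eq_iff transpose_def)

lemma transpose_msmult: "transpose (c \<odot> A) = c \<odot> transpose A"
  by (simp add: vec_eq_iff transpose_def msmult_component)

lemma transpose_kron: "transpose (A \<otimes> B) = transpose A \<otimes> transpose B"
  by (simp add: vec_eq_iff transpose_def kron_def)

lemma transpose_E: "transpose (E i j) = E j i"
  by (auto simp: vec_eq_iff transpose_def E_def)

section \<open>Strings of weight vectors\<close>

text \<open>\<open>E\<^sub>1\<close> moves down the string by one index with nonzero factors.
  Applied repeatedly to a combination with leading index \<open>n\<close>, it therefore ends in a
  nonzero multiple of \<open>w 0\<close>. This gives both linear independence and irreducibility;
  \<open>F\<^sub>1\<close> then rebuilds the string from \<open>w 0\<close>.\<close>

lemma A1_irreducible_string:
  fixes w :: "nat \<Rightarrow> complex^'n" and M :: "'n::finite gens"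
  assumes w0: "w 0 \<noteq> 0"
    and F: "\<And>i. i < k \<Longrightarrow> gF M 1 *v w i = f i *s w (Suc i)" "\<And>i. i < k \<Longrightarrow> f i \<noteq> 0"
      "gF M 1 *v w k = 0"
    and E: "gE M 1 *v w 0 = 0" "\<And>i. i < k \<Longrightarrow> gE M 1 *v w (Suc i) = e i *s w i"
      "\<And>i. i < k \<Longrightarrow> e i \<noteq> 0"
    and K: "\<And>i. i \<le> k \<Longrightarrow> gK M 1 *v w i = (s powi m i) *s w i"
  shows "A1_irreducible s M k (vec.span (w ` {..k}))"
proof -
  define W where "W = vec.span (w ` {..k})"
  have wW: "w i \<in> W" if "i \<le> k" for i
    using that by (auto simp: W_def intro: vec.span_base)
  have subW: "vec.subspace W" by (simp add: W_def)
  have Esum: "gE M 1 *v (\<Sum>i\<le>Suc n. c i *s w i) = (\<Sum>i\<le>n. (c (Suc i) * e i) *s w i)" if "n < k" for n c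
    using that
    by (simp add: sum.atMost_Suc_shift matrix_vector_right_distrib vec.sum matrix_vector_mult_scaleR
         vec.scale E[simplified] del: sum.atMost_Suc)
  \<comment> \<open>Stated for an arbitrary \<open>E\<^sub>1\<close>-stable subspace because it
    serves twice: with \<open>{0}\<close> for linear independence, and with a nonzero submodule for
    irreducibility.\<close>
  have climb: "w 0 \<in> U" if "vec.subspace U" "\<And>u. u \<in> U \<Longrightarrow> gE M 1 *v u \<in> U"
      "n \<le> k" "c n \<noteq> 0" "(\<Sum>i\<le>n. c i *s w i) \<in> U" for U n and c :: "nat \<Rightarrow> complex"
    using that(3-5)
  proof (induction n arbitrary: c)
    case 0
    then show ?case using vec.subspace_scale[OF that(1), of "c 0 *s w 0" "inverse (c 0)"] by simp
  next
    case (Suc n)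
    then show ?case
      using Suc.IH[of "\<lambda>i. c (Suc i) * e i"] that(2)[OF Suc.prems(3)] E(3)[of n] Esum[of n c] by simp
  qed
  have top: "\<exists>n\<le>k. c n \<noteq> 0 \<and> (\<Sum>i\<le>k. c i *s w i) = (\<Sum>i\<le>n. c i *s w i)"
    if "\<exists>i\<le>k. c i \<noteq> 0" for c :: "nat \<Rightarrow> complex"
  proof -
    define n where "n = Max {i. i \<le> k \<and> c i \<noteq> 0}"
    have "n \<in> {i. i \<le> k \<and> c i \<noteq> 0}" unfolding n_def by (rule Max_in) (use that in auto)
    moreover have "i \<le> n" if "i \<le> k" "c i \<noteq> 0" for i
      using that Max_ge[of "{i. i \<le> k \<and> c i \<noteq> 0}" i] unfolding n_def by auto
    ultimately show ?thesis
      by (intro exI[of _ n]) (auto intro!: sum.mono_neutral_right)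
  qed
  have coeffs: "\<forall>i\<le>k. c i = 0" if "(\<Sum>i\<le>k. c i *s w i) = 0" for c :: "nat \<Rightarrow> complex"
  proof (rule ccontr)
    assume "\<not> (\<forall>i\<le>k. c i = 0)"
    then have "\<exists>i\<le>k. c i \<noteq> 0" by blast
    from top[OF this] that obtain n where "n \<le> k" "c n \<noteq> 0" "(\<Sum>i\<le>n. c i *s w i) = 0" by metis
    then have "w 0 \<in> {0}" by (intro climb[of "{0}" n c]) auto
    then show False using w0 by simp
  qed
  have inj: "inj_on w {..k}"
  proof (rule inj_onI, rule ccontr)
    fix i j assume ij: "i \<in> {..k}" "j \<in> {..k}" "w i = w j" "i \<noteq> j"
    \<comment> \<open>A coincidence \<open>w i = w j\<close> is read as a linear relation with
      coefficients \<open>1\<close> and \<open>-1\<close>, which \<open>coeffs\<close>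
      forbids.\<close>
    have "(\<Sum>l\<le>k. ((if l = i then 1 else 0) - (if l = j then 1 else 0)) *s w l) = 0"
      using ij by (simp add: vec.scale_left_diff_distrib sum_subtractf if_distrib[of "\<lambda>x. x *s _"] cong: if_cong)
    from coeffs[OF this] ij show False by (auto split: if_splits)
  qed
  have indep: "vec.independent (w ` {..k})"
    unfolding vec.independent_explicit_finite_subsets
  proof (intro allI impI)
    fix A u assume A: "A \<subseteq> w ` {..k}" "finite A" "(\<Sum>v\<in>A. u v *s v) = 0"
    have "(\<Sum>i\<le>k. (if w i \<in> A then u (w i) else 0) *s w i) = (\<Sum>v\<in>w ` {..k}. (if v \<in> A then u v else 0) *s v)"
      by (simp add: sum.reindex[OF inj])
    also have "\<dots> = (\<Sum>v\<in>A. u v *s v)"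
      using A(1) by (intro sum.mono_neutral_cong_right) auto
    finally have "\<forall>i\<le>k. (if w i \<in> A then u (w i) else 0) = 0" using A(3) by (intro coeffs) simp
    then show "\<forall>v\<in>A. u v = 0" using A(1) by fastforce
  qed
  have dim: "vec.dim W = k + 1"
    unfolding W_def using vec.dim_eq_card_independent[OF indep] card_image[OF inj] by simp
  have span: "\<exists>c. u = (\<Sum>i\<le>k. c i *s w i)" if "u \<in> W" for u
  proof -
    from that obtain c where "u = (\<Sum>v\<in>w ` {..k}. c v *s v)"
      unfolding W_def vec.span_finite[OF finite_imageI[OF finite_atMost]] by auto
    then show ?thesis by (auto simp: sum.reindex[OF inj])
  qed
  have inv: "A *v u \<in> W" if "u \<in> W" "\<And>i. i \<le> k \<Longrightarrow> A *v w i \<in> W" for A u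
  proof -
    from span[OF that(1)] obtain c where "u = (\<Sum>i\<le>k. c i *s w i)" by blast
    then show ?thesis
      by (auto simp: vec.sum vec.scale intro!: vec.subspace_sum[OF subW] vec.subspace_scale[OF subW] that(2))
  qed
  have "gE M 1 *v w i \<in> W" if "i \<le> k" for i
    using that E vec.subspace_0[OF subW] by (cases i) (auto intro!: vec.subspace_scale[OF subW] wW)
  moreover have "gF M 1 *v w i \<in> W" if "i \<le> k" for i
    using that F vec.subspace_0[OF subW] by (cases "i = k") (auto intro!: vec.subspace_scale[OF subW] wW)
  moreover have "gK M 1 *v w i \<in> W" if "i \<le> k" for i
    using that K by (auto intro!: vec.subspace_scale[OF subW] wW)
  ultimately have invW: "A1_invariant M W"
    unfolding A1_invariant_def using subW inv by blast
  have "U = W" if U: "U \<subseteq> W" "A1_invariant M U" "U \<noteq> {0}" for U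
  proof -
    have subU: "vec.subspace U" and EU: "\<And>u. u \<in> U \<Longrightarrow> gE M 1 *v u \<in> U"
      and FU: "\<And>u. u \<in> U \<Longrightarrow> gF M 1 *v u \<in> U"
      using U(2) by (auto simp: A1_invariant_def)
    obtain u where u: "u \<in> U" "u \<noteq> 0" using U(3) vec.subspace_0[OF subU] by blast
    then obtain c where c: "u = (\<Sum>i\<le>k. c i *s w i)" using span U(1) by blast
    have "\<exists>i\<le>k. c i \<noteq> 0"
    proof (rule ccontr)
      assume "\<not> (\<exists>i\<le>k. c i \<noteq> 0)"
      then have "u = 0" unfolding c by (intro sum.neutral) auto
      then show False using u(2) by simp
    qed
    from top[OF this] obtain n where "n \<le> k" "c n \<noteq> 0" "(\<Sum>i\<le>n. c i *s w i) \<in> U" using c u(1) by auto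
    then have "w 0 \<in> U" using climb[OF subU EU] by blast
    then have "w i \<in> U" if "i \<le> k" for i
      using that
    proof (induction i)
      case (Suc i)
      then have "f i *s w (Suc i) \<in> U" using FU[of "w i"] F(1)[of i] by simp
      then have "inverse (f i) *s (f i *s w (Suc i)) \<in> U" by (rule vec.subspace_scale[OF subU])
      then show ?case using F(2)[of i] Suc.prems by simp
    qed auto
    then have "W \<subseteq> U" unfolding W_def using subU by (intro vec.span_minimal) auto
    then show ?thesis using U(1) by blast
  qed
  moreover have "W \<subseteq> vec.span {w\<in>W. \<exists>m::int. gK M 1 *v w = (s powi m) *s w}"
    unfolding W_def using wW K by (intro vec.span_mono) (auto simp: W_def[symmetric])
  ultimately show ?thesis
    unfolding A1_irreducible_def using invW dim by (auto simp: W_def)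
qed

text \<open>The \<open>P j\<close> commute with node \<open>1\<close>, so each is zero or injective on the irreducible \<open>W\<close>; in the
  second case it maps \<open>W\<close> onto \<open>V j\<close>, and the dimension \<open>j + 1\<close> tells the summands apart.\<close>

lemma A1_irreducible_eq_summand:
  fixes M :: "'n::finite gens" and P :: "nat \<Rightarrow> complex^'n^'n"
  assumes J: "finite J" and V: "\<And>j. j \<in> J \<Longrightarrow> A1_irreducible s M j (V j)"
    and PV: "\<And>j v. j \<in> J \<Longrightarrow> P j *v v \<in> V j"
    and P: "\<And>j l v. j \<in> J \<Longrightarrow> l \<in> J \<Longrightarrow> v \<in> V l \<Longrightarrow> P j *v v = (if j = l then v else 0)"
    and sum: "(\<Sum>j\<in>J. P j) = mat 1"
    and k: "k \<in> J" and W: "A1_irreducible s M k W"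
  shows "W = V k"
proof -
  have decomp: "v = (\<Sum>j\<in>J. P j *v v)" for v
  proof -
    have "v = (\<Sum>j\<in>J. P j) *v v" by (simp add: sum)
    also have "\<dots> = (\<Sum>j\<in>J. P j *v v)"
      using J by (induction J rule: finite_induct) (auto simp: matrix_vector_mult_add_rdistrib)
    finally show ?thesis .
  qed
  have Vinv: "A1_invariant M (V j)" if "j \<in> J" for j using V[OF that] by (simp add: A1_irreducible_def)
  have Winv: "A1_invariant M W" and dimW: "vec.dim W = k + 1"
    and Wirr: "\<And>U. U \<subseteq> W \<Longrightarrow> A1_invariant M U \<Longrightarrow> U = {0} \<or> U = W"
    using W by (auto simp: A1_irreducible_def)
  have subW: "vec.subspace W" using Winv by (simp add: A1_invariant_def)
  \<comment> \<open>An operator that preserves every \<open>V l\<close> commutes with every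
    \<open>P j\<close>; the three generators of node \<open>1\<close> are of this kind.\<close>
  have comm: "P j *v (A *v v) = A *v (P j *v v)" if "j \<in> J" "\<And>l u. l \<in> J \<Longrightarrow> u \<in> V l \<Longrightarrow> A *v u \<in> V l" for j A v
  proof -
    have "P j *v (A *v v) = (\<Sum>l\<in>J. P j *v (A *v (P l *v v)))"
      by (subst decomp[of v]) (simp add: vec.sum)
    also have "\<dots> = (\<Sum>l\<in>J. if l = j then A *v (P j *v v) else 0)"
      using that PV P by (intro sum.cong) auto
    finally show ?thesis using J that(1) by simp
  qed
  have commg: "P j *v (gE M 1 *v v) = gE M 1 *v (P j *v v)" "P j *v (gF M 1 *v v) = gF M 1 *v (P j *v v)"
     "P j *v (gK M 1 *v v) = gK M 1 *v (P j *v v)" if "j \<in> J" for j v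
    using comm[OF that] Vinv by (auto simp: A1_invariant_def)
  have zero: "P j *v v = 0" if "j \<in> J" "j \<noteq> k" "v \<in> W" for j v
  proof (rule ccontr)
    assume nz: "P j *v v \<noteq> 0"
    define U where "U = {u \<in> W. P j *v u = 0}"
    have "A1_invariant M U"
      using Winv commg[OF that(1)]
      by (auto simp: U_def A1_invariant_def vec.subspace_def vec.add vec.scale)
    then have U: "U = {0}" using Wirr[of U] nz that(3) by (auto simp: U_def)
    define I where "I = (*v) (P j) ` W"
    have "A1_invariant M I"
      unfolding A1_invariant_def
    proof (intro conjI ballI)
      show "vec.subspace I" unfolding I_def using subW by (intro vec.subspace_image)
    qed (use Winv commg[OF that(1), symmetric] in \<open>auto simp: I_def A1_invariant_def\<close>)
    moreover have "I \<subseteq> V j" using PV[OF that(1)] by (auto simp: I_def)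
    moreover have "I \<noteq> {0}" using nz that(3) by (auto simp: I_def)
    ultimately have "I = V j" using V[OF that(1)] by (auto simp: A1_irreducible_def)
    then have "vec.dim I = j + 1" using V[OF that(1)] by (simp add: A1_irreducible_def)
    moreover have "inj_on ((*v) (P j)) (vec.span W)"
      unfolding vec.span_eq_iff[THEN iffD2, OF subW]
    proof (rule inj_onI)
      fix x y assume "x \<in> W" "y \<in> W" "P j *v x = P j *v y"
      then have "x - y \<in> U" by (auto simp: U_def vec.diff vec.subspace_diff[OF subW])
      then show "x = y" using U by simp
    qed
    then have "vec.dim I = k + 1"
      unfolding I_def using vec.dim_image_eq[OF matrix_vector_mul_linear_gen, of "P j" W] dimW by simp
    ultimately show False using that(2) by simp
  qed
  have "W \<subseteq> V k"
  proof
    fix v assume "v \<in> W"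
    then have "v = (\<Sum>j\<in>J. if j = k then P k *v v else 0)"
      using zero by (subst decomp) (auto intro!: sum.cong)
    then have "v = P k *v v" using J k by simp
    then show "v \<in> V k" using PV[OF k, of v] by simp
  qed
  moreover have "W \<noteq> {0}"
  proof
    assume "W = {0}"
    then show False using dimW by simp
  qed
  ultimately show ?thesis using V[OF k] Winv by (auto simp: A1_irreducible_def)
qed

section \<open>Rational functions\<close>

text \<open>Two quotients that agree off a finite set satisfy a polynomial identity after cross
  multiplication, since a nonzero polynomial has finitely many roots. The identity then holds at
  every point, including those of \<open>S\<close>.\<close>

lemma rational_op_eq:
  fixes N' :: "complex poly^'n^'n"
  assumes R: "rational_op R" and d': "poly d' z \<noteq> 0" and S: "finite S"
    and eq: "\<And>z. z \<notin> S \<Longrightarrow> poly d' z \<noteq> 0 \<Longrightarrow> R z = (\<chi> i j. poly (N' $ i $ j) z / poly d' z)"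
  shows "R z = (\<chi> i j. poly (N' $ i $ j) z / poly d' z)"
proof -
  from R obtain N :: "complex poly^'n^'n" and d where d: "d \<noteq> 0"
    and pole: "\<And>z. poly d z = 0 \<Longrightarrow> \<exists>i j. poly (N $ i $ j) z \<noteq> 0"
    and Rz: "\<And>z. poly d z \<noteq> 0 \<Longrightarrow> R z = (\<chi> i j. poly (N $ i $ j) z / poly d z)"
    unfolding rational_op_def by blast
  have "d' \<noteq> 0" using d' by auto
  have cross: "d' * N $ i $ j = d * N' $ i $ j" for i j
  proof (rule ccontr)
    let ?p = "d' * N $ i $ j - d * N' $ i $ j"
    assume "d' * N $ i $ j \<noteq> d * N' $ i $ j"
    then have "finite (S \<union> {z. poly d z = 0} \<union> {z. poly d' z = 0} \<union> {z. poly ?p z = 0})"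
      using S d \<open>d' \<noteq> 0\<close> by (intro finite_UnI poly_roots_finite) auto
    from ex_new_if_finite[OF infinite_UNIV_char_0 this]
    obtain x where x: "x \<notin> S" "poly d x \<noteq> 0" "poly d' x \<noteq> 0" "poly ?p x \<noteq> 0" by auto
    have "poly (N $ i $ j) x / poly d x = R x $ i $ j" by (subst Rz[OF x(2)]) simp
    also have "\<dots> = poly (N' $ i $ j) x / poly d' x" by (subst eq[OF x(1,3)]) simp
    finally have "poly (N $ i $ j) x / poly d x = poly (N' $ i $ j) x / poly d' x" .
    then show False using x by (simp add: field_simps)
  qed
  have *: "poly d' z * poly (N $ i $ j) z = poly d z * poly (N' $ i $ j) z" for i j
    using arg_cong[OF cross[of i j], of "\<lambda>p. poly p z"] by simp
  \<comment> \<open>If \<open>d\<close> vanished at \<open>z\<close>, then \<open>*\<close> and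
    \<open>poly d' z \<noteq> 0\<close> would make every entry of \<open>N\<close> vanish there too,
    contradicting the absence of cancellable zeros in \<open>rational_op\<close>.\<close>
  have dz: "poly d z \<noteq> 0"
    using pole[of z] * d' by auto
  have "poly (N $ i $ j) z / poly d z = poly (N' $ i $ j) z / poly d' z" for i j
    using *[of i j] dz d' by (simp add: field_simps)
  then show ?thesis unfolding Rz[OF dz] by simp
qed

section \<open>The action on the tensor product\<close>

text \<open>The matrix-unit side of the theorem serves as the candidate. It is shown to be the
  R-matrix, and its spectral form is derived in \<open>Rmat_proj\<close>.\<close>

definition Rmat :: "complex \<Rightarrow> complex \<Rightarrow> complex \<Rightarrow> complex^(3 \<times> 3)^(3 \<times> 3)"
  where "Rmat q s z = R_sl3 q z + ((q - inverse q) * (1 - z) /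
                  ((q - inverse q * z) * (s ^ 3 + s powi (-3) * z))) \<odot> Qmat q s z"

lemmas mv_simps = matrix_vector_mult_add_rdistrib matrix_vector_mult_diff_rdistrib msmult_mult_vec
   kron_mult_vec sum_3 E_component msmult_component

locale quantum_parameters =
  fixes q s r :: complex
  assumes q0: "q \<noteq> 0" and not_root: "\<forall>n>0. q ^ n \<noteq> 1" and s: "s ^ 2 = q"
    and r: "r ^ 2 = s + inverse s"
begin

abbreviation V2 where "V2 a b \<equiv> tensor q s (L1 q r a) (L1 q r b)"

lemmas Khalf_L1_simps = Khalf_L1[OF q0 not_root s] Khalf_L1(2)[OF q0 not_root s, simplified]

lemma gE1: "gE (V2 a b) 1 = (r \<odot> (E 1 2 + E 2 3)) \<otimes> (s \<odot> E 1 1 + E 2 2 + inverse s \<odot> E 3 3) +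
  (inverse s \<odot> E 1 1 + E 2 2 + s \<odot> E 3 3) \<otimes> (r \<odot> (E 1 2 + E 2 3))"
  by (simp add: tensor_def Khalf_L1_simps power_int_minus, simp add: gens_L1_simps)

lemma gF1: "gF (V2 a b) 1 = (r \<odot> (E 2 1 + E 3 2)) \<otimes> (s \<odot> E 1 1 + E 2 2 + inverse s \<odot> E 3 3) +
  (inverse s \<odot> E 1 1 + E 2 2 + s \<odot> E 3 3) \<otimes> (r \<odot> (E 2 1 + E 3 2))"
  by (simp add: tensor_def Khalf_L1_simps power_int_minus, simp add: gens_L1_simps)

lemma gE0: "gE (V2 a b) 0 = (a \<odot> E 3 1) \<otimes> (inverse q \<odot> E 1 1 + E 2 2 + q \<odot> E 3 3) +
  (q \<odot> E 1 1 + E 2 2 + inverse q \<odot> E 3 3) \<otimes> (b \<odot> E 3 1)"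
  by (simp add: tensor_def Khalf_L1_simps power_int_minus, simp add: gens_L1_simps)

lemma gF0: "a \<noteq> 0 \<Longrightarrow> b \<noteq> 0 \<Longrightarrow> gF (V2 a b) 0 = (inverse a \<odot> E 1 3) \<otimes> (inverse q \<odot> E 1 1 + E 2 2 + q \<odot> E 3 3) +
  (q \<odot> E 1 1 + E 2 2 + inverse q \<odot> E 3 3) \<otimes> (inverse b \<odot> E 1 3)"
  by (simp add: tensor_def Khalf_L1_simps power_int_minus, simp add: gens_L1_simps)

lemma gE1_mv:
 "(gE (V2 a b) 1 *v v) $ (1,1) = r * (s * v $ (2,1) + inverse s * v $ (1,2))"
 "(gE (V2 a b) 1 *v v) $ (1,2) = r * (v $ (2,2) + inverse s * v $ (1,3))"
 "(gE (V2 a b) 1 *v v) $ (1,3) = r * (inverse s * v $ (2,3))"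
 "(gE (V2 a b) 1 *v v) $ (2,1) = r * (s * v $ (3,1) + v $ (2,2))"
 "(gE (V2 a b) 1 *v v) $ (2,2) = r * (v $ (3,2) + v $ (2,3))"
 "(gE (V2 a b) 1 *v v) $ (2,3) = r * (inverse s * v $ (3,3))"
 "(gE (V2 a b) 1 *v v) $ (3,1) = r * (s * v $ (3,2))"
 "(gE (V2 a b) 1 *v v) $ (3,2) = r * (s * v $ (3,3))"
 "(gE (V2 a b) 1 *v v) $ (3,3) = 0"
  by (simp_all add: gE1[simplified] mv_simps algebra_simps)

lemma gF1_mv:
 "(gF (V2 a b) 1 *v v) $ (1,1) = 0"
 "(gF (V2 a b) 1 *v v) $ (1,2) = r * (inverse s * v $ (1,1))"
 "(gF (V2 a b) 1 *v v) $ (1,3) = r * (inverse s * v $ (1,2))"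
 "(gF (V2 a b) 1 *v v) $ (2,1) = r * (s * v $ (1,1))"
 "(gF (V2 a b) 1 *v v) $ (2,2) = r * (v $ (1,2) + v $ (2,1))"
 "(gF (V2 a b) 1 *v v) $ (2,3) = r * (inverse s * v $ (1,3) + v $ (2,2))"
 "(gF (V2 a b) 1 *v v) $ (3,1) = r * (s * v $ (2,1))"
 "(gF (V2 a b) 1 *v v) $ (3,2) = r * (s * v $ (3,1) + v $ (2,2))"
 "(gF (V2 a b) 1 *v v) $ (3,3) = r * (inverse s * v $ (2,3) + s * v $ (3,2))"
  by (simp_all add: gF1[simplified] mv_simps algebra_simps)

lemma gE0_mv:
 "(gE (V2 a b) 0 *v v) $ (1,1) = 0" "(gE (V2 a b) 0 *v v) $ (1,2) = 0" "(gE (V2 a b) 0 *v v) $ (2,1) = 0"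
 "(gE (V2 a b) 0 *v v) $ (1,3) = b * q * v $ (1,1)"
 "(gE (V2 a b) 0 *v v) $ (3,1) = a * inverse q * v $ (1,1)"
 "(gE (V2 a b) 0 *v v) $ (2,2) = 0"
 "(gE (V2 a b) 0 *v v) $ (2,3) = b * v $ (2,1)"
 "(gE (V2 a b) 0 *v v) $ (3,2) = a * v $ (1,2)"
 "(gE (V2 a b) 0 *v v) $ (3,3) = a * q * v $ (1,3) + b * inverse q * v $ (3,1)"
  by (simp_all add: gE0[simplified] mv_simps algebra_simps)

section \<open>Coordinates of the expression in matrix units\<close>

lemma idx_sets: "{(i,j)\<in>idx. i < j} = {(1,2),(1,3),(2,3)}"
 "{(i,j)\<in>idx. i > j} = {(2,1),(3,1),(3,2)}"
 "{(i,j)\<in>idx. i \<noteq> j} = {(1,2),(1,3),(2,3),(2,1),(3,1),(3,2)}"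
 "{(i,j)\<in>idx. i+j < 4} = {(1,1),(1,2),(2,1)}"
 "{(i,j)\<in>idx. i+j > 4} = {(2,3),(3,2),(3,3)}"
 "{(i,j)\<in>idx. i+j = 4 \<and> i \<noteq> 2} = {(1,3),(3,1)}"
  unfolding idx_def by (simp_all only: atLeastAtMost_insertL flip: atLeastLessThanSuc_atLeastAtMost) (auto simp: le_Suc_eq numeral_eq_Suc)

lemma s_nz: "s \<noteq> 0" using s q0 by auto

lemma sum_1_3: "(\<Sum>i=1..3. f i) = f 1 + f 2 + f (3::nat)"
  by (simp add: numeral_3_eq_3 numeral_2_eq_2)

lemma R_sl3_mv:
  fixes z
  defines "x \<equiv> (q - inverse q) / (q - inverse q * z)" and "y \<equiv> (1 - z) / (q - inverse q * z)"
  shows "(R_sl3 q z *v v) $ (1,1) = v $ (1,1)"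
 "(R_sl3 q z *v v) $ (1,2) = z * x * v $ (1,2) + y * v $ (2,1)"
 "(R_sl3 q z *v v) $ (1,3) = z * x * v $ (1,3) + y * v $ (3,1)"
 "(R_sl3 q z *v v) $ (2,1) = x * v $ (2,1) + y * v $ (1,2)"
 "(R_sl3 q z *v v) $ (2,2) = v $ (2,2)"
 "(R_sl3 q z *v v) $ (2,3) = z * x * v $ (2,3) + y * v $ (3,2)"
 "(R_sl3 q z *v v) $ (3,1) = x * v $ (3,1) + y * v $ (1,3)"
 "(R_sl3 q z *v v) $ (3,2) = x * v $ (3,2) + y * v $ (2,3)"
 "(R_sl3 q z *v v) $ (3,3) = v $ (3,3)"
  by (simp_all add: R_sl3_def idx_sets[simplified] sum_1_3[simplified] mv_simps) (simp_all add: x_def y_def)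

text \<open>The matrix unit product for \<open>(i, j)\<close> sends
  \<open>v\<^sub>j \<otimes> v\<^sub>4\<^sub>-\<^sub>j\<close> to
  \<open>v\<^sub>i \<otimes> v\<^sub>4\<^sub>-\<^sub>i\<close>. Hence \<open>Qmat\<close> lives on
  the zero weight space, with coordinates \<open>(1,3)\<close>, \<open>(2,2)\<close> and
  \<open>(3,1)\<close>.\<close>

lemma Qmat_mv:
 "(Qmat q s z *v v) $ (1,1) = 0" "(Qmat q s z *v v) $ (1,2) = 0" "(Qmat q s z *v v) $ (2,1) = 0"
 "(Qmat q s z *v v) $ (3,3) = 0" "(Qmat q s z *v v) $ (3,2) = 0" "(Qmat q s z *v v) $ (2,3) = 0"
 "(Qmat q s z *v v) $ (1,3) = z * inverse s * v $ (1,3) - z * inverse q * v $ (2,2) - (q - inverse q * z) / (s + inverse s) * v $ (3,1)"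
 "(Qmat q s z *v v) $ (2,2) = - z * inverse q * v $ (1,3) - (q^2 - inverse q ^ 2 * z) / (s + inverse s) * v $ (2,2) + q * v $ (3,1)"
 "(Qmat q s z *v v) $ (3,1) = - (q - inverse q * z) / (s + inverse s) * v $ (1,3) + q * v $ (2,2) - s * v $ (3,1)"
  using s_nz by (simp_all add: Qmat_def idx_sets[simplified] sum_1_3[simplified] mv_simps eps_def power_int_minus)
   (simp_all add: s[symmetric] power2_eq_square power3_eq_cube field_simps flip: add_divide_distrib)

section \<open>Weight vectors and projectors\<close>

text \<open>For \<open>k = 4, 2, 0\<close>: \<open>weight_vec k i\<close>, with \<open>i \<le> k\<close>, is proportional to \<open>F\<^sub>1\<^sup>i\<close> applied to the
  highest weight vector of weight \<open>k\<close>, and \<open>rho k z\<close> is the eigenvalue of \<open>Rmat q s z\<close> on it.\<close>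

definition weight_vec :: "nat \<Rightarrow> nat \<Rightarrow> complex^(3 \<times> 3)" where
  "weight_vec k i = (if k = 4 then
      [axis (1,1) 1,
       s *s axis (2,1) 1 + inverse s *s axis (1,2) 1,
       q *s axis (3,1) 1 + (s + inverse s) *s axis (2,2) 1 + inverse q *s axis (1,3) 1,
       s *s axis (3,2) 1 + inverse s *s axis (2,3) 1,
       axis (3,3) 1] ! i
    else if k = 2 then
      [inverse s *s axis (2,1) 1 - s *s axis (1,2) 1,
       axis (3,1) 1 + (inverse s - s) *s axis (2,2) 1 - axis (1,3) 1,
       inverse s *s axis (3,2) 1 - s *s axis (2,3) 1] ! i
    else inverse s *s axis (3,1) 1 - axis (2,2) 1 + s *s axis (1,3) 1)"

definition rho :: "nat \<Rightarrow> complex \<Rightarrow> complex" where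
  "rho k z = (if k = 4 then 1
    else if k = 2 then - (q powi (-2) * ((1 - q ^ 2 * z) / (1 - q powi (-2) * z)))
    else q powi (-3) * ((1 + q ^ 3 * z) / (1 + q powi (-3) * z)))"

lemma s2_plus1: "s ^ 2 + 1 \<noteq> 0"
proof
  assume "s^2 + 1 = 0"
  then have "q = -1" unfolding s by (simp add: add_eq_0_iff2)
  then have "q ^ 2 = 1" by simp
  then show False using not_root by simp
qed

lemma all_weights: "(\<forall>k\<in>{0,2,4}. \<forall>i\<le>k. Q k i) \<longleftrightarrow> Q 4 0 \<and> Q 4 1 \<and> Q 4 2 \<and> Q 4 3 \<and> Q 4 4 \<and>
   Q 2 0 \<and> Q 2 1 \<and> Q (2::nat) (2::nat) \<and> Q 0 0"
  by (auto simp: le_Suc_eq numeral_eq_Suc)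

text \<open>In terms of \<open>s\<close>, where \<open>q = s\<^sup>2\<close>, all coefficients are quotients of polynomials.\<close>

lemma R_coefficients:
  assumes "z \<noteq> q ^ 2" "z \<noteq> - (q ^ 3)"
  shows "(q - inverse q) / (q - inverse q * z) = (s^4 - 1) / (s^4 - z)"
    "(1 - z) / (q - inverse q * z) = s^2 * (1-z) / (s^4 - z)"
    "(q - inverse q) * (1 - z) / ((q - inverse q * z) * (s ^ 3 + s powi (-3) * z))
      = s^3 * (s^4-1) * (1-z) / ((s^4 - z) * (s^6 + z))"
    "(q - inverse q * z) / (s + inverse s) = (s^4-z) / (s * (s^2+1))"
    "(q\<^sup>2 - (inverse q)\<^sup>2 * z) / (s + inverse s) = (s^8-z) / (s^3 * (s^2+1))"
    "rho 2 z = - (1 - s^4*z) / (s^4 - z)"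
    "rho 0 z = (1 + s^6*z) / (s^6 + z)"
    "s^4 - z \<noteq> 0" "s^6 + z \<noteq> 0"
proof -
  show n: "s^4 - z \<noteq> 0" "s^6 + z \<noteq> 0"
    using assms by (auto simp: s[symmetric] add_eq_0_iff2 simp flip: power_mult)
  have D: "q - inverse q * z = (s^4 - z) / s^2" "q - inverse q = (s^4 - 1) / s^2"
     "q\<^sup>2 - (inverse q)\<^sup>2 * z = (s^8-z) / s^4"
    using s_nz by (simp_all add: s[symmetric] field_simps flip: power_mult power_add)
  have D': "s ^ 3 + s powi (-3) * z = (s^6 + z) / s^3" "s + inverse s = (s^2 + 1) / s"
    using s_nz by (simp_all add: power_int_minus field_simps power2_eq_square flip: power_mult power_add)
  have D'': "1 - q powi (-2) * z = (s^4 - z) / s^4" "1 + q powi (-3) * z = (s^6 + z) / s^6"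
     "q powi (-2) = 1 / s^4" "q powi (-3) = 1 / s^6"
    using s_nz by (simp_all add: s[symmetric] power_int_minus field_simps flip: power_mult power_add)
  note nz = n s_nz s2_plus1
  show "(q - inverse q) / (q - inverse q * z) = (s^4 - 1) / (s^4 - z)"
    "(1 - z) / (q - inverse q * z) = s^2 * (1-z) / (s^4 - z)"
    unfolding D using nz by (simp_all add: divide_simps)
  show "(q - inverse q * z) / (s + inverse s) = (s^4-z) / (s * (s^2+1))"
    "(q\<^sup>2 - (inverse q)\<^sup>2 * z) / (s + inverse s) = (s^8-z) / (s^3 * (s^2+1))"
    unfolding D D' using nz by (simp_all add: divide_simps) (simp_all add: power2_eq_square power4_eq_xxxx power3_eq_cube)
  show "(q - inverse q) * (1 - z) / ((q - inverse q * z) * (s ^ 3 + s powi (-3) * z))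
      = s^3 * (s^4-1) * (1-z) / ((s^4 - z) * (s^6 + z))"
    unfolding D D' using nz by (simp add: divide_simps numeral_eq_Suc)
  show "rho 2 z = - (1 - s^4*z) / (s^4 - z)"
    "rho 0 z = (1 + s^6*z) / (s^6 + z)"
    unfolding rho_def D'' using nz by (simp_all add: s[symmetric] divide_simps flip: power_mult)
qed

lemma Rmat_mv: "(Rmat q s z *v v) = R_sl3 q z *v v + ((q - inverse q) * (1 - z) /
                  ((q - inverse q * z) * (s ^ 3 + s powi (-3) * z))) *s (Qmat q s z *v v)"
  by (simp add: Rmat_def matrix_vector_mult_add_rdistrib msmult_mult_vec)

text \<open>The source of the projector formula, verified coordinate by coordinate. The two excluded
  values of \<open>z\<close> are the zeros of the denominators \<open>s^4 - z\<close> and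
  \<open>s^6 + z\<close>.\<close>

lemma Rmat_weight_vec:
  assumes "z \<noteq> q ^ 2" "z \<noteq> - (q ^ 3)"
  shows "\<forall>k\<in>{0,2,4}. \<forall>i\<le>k. Rmat q s z *v weight_vec k i = rho k z *s weight_vec k i"
proof -
  have s2_plus1': "s * s + 1 \<noteq> 0" using s2_plus1 by (simp add: power2_eq_square)
  note cf = R_coefficients[OF assms]
  have [simp]: "rho 4 z = 1" by (simp add: rho_def)
  show ?thesis
    unfolding all_weights Rmat_mv vec_eq_iff_3x3 forall_3
    by (simp add: R_sl3_mv Qmat_mv cf(1-7) weight_vec_def axis_def del: divide_eq_eq eq_divide_eq,
      intro conjI,
      use cf(8,9) s_nz s2_plus1 s2_plus1' in \<open>simp_all add: s[symmetric] divide_simps flip: power_mult\<close>,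
      simp_all add: power2_eq_square power3_eq_cube power4_eq_xxxx numeral_eq_Suc algebra_simps)
qed

text \<open>\<open>E\<^sub>0\<close> mixes the three summands, so this relation cannot be read off
  from the eigenvalues on them and is checked directly.\<close>

lemma Rmat_gE0:
  assumes "b \<noteq> 0" "a / b \<noteq> q ^ 2" "a / b \<noteq> - (q ^ 3)"
  shows "Rmat q s (a / b) *v (gE (V2 a b) 0 *v v) = gE (V2 b a) 0 *v (Rmat q s (a / b) *v v)"
proof -
  define z where "z = a / b"
  \<comment> \<open>With \<open>a\<close> eliminated, the coordinates become rational identities in
    \<open>s\<close>, \<open>z\<close> and \<open>b\<close>.\<close>
  have a: "a = z * b" using assms by (simp add: z_def)
  have s2_plus1': "s * s + 1 \<noteq> 0" using s2_plus1 by (simp add: power2_eq_square)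
  note cf = R_coefficients[OF assms(2,3), folded z_def]
  show ?thesis
    unfolding Rmat_mv vec_eq_iff_3x3 forall_3 z_def[symmetric]
    by (simp add: gE0_mv R_sl3_mv Qmat_mv cf(1-7) del: divide_eq_eq eq_divide_eq,
      intro conjI,
      use cf(8,9) s_nz s2_plus1 s2_plus1' in \<open>simp_all add: a s[symmetric] divide_simps flip: power_mult\<close>,
      simp_all add: power2_eq_square power3_eq_cube power4_eq_xxxx numeral_eq_Suc algebra_simps)
qed

section \<open>An orthogonal basis and its explicit projectors\<close>

definition weight_norm :: "nat \<Rightarrow> nat \<Rightarrow> complex" where
  "weight_norm k i = (if k = 4 then [1, q + inverse q, (q + inverse q) * (q + 1 + inverse q), q + inverse q, 1] ! i
     else if k = 2 then q + inverse q else q + 1 + inverse q)"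

text \<open>Bilinear, without complex conjugation, so that transposition is the adjoint. Nonzero
  vectors may be isotropic for such a form, hence the separate check that the values
  \<open>weight_norm\<close> of the self-pairings do not vanish.\<close>

definition dot :: "complex^(3 \<times> 3) \<Rightarrow> complex^(3 \<times> 3) \<Rightarrow> complex" where
  "dot v w = (\<Sum>p\<in>UNIV. v $ p * w $ p)"

lemma dot_weight_vec:
  "\<forall>k\<in>{0,2,4}. \<forall>i\<le>k. \<forall>l\<in>{0,2,4}. \<forall>j\<le>l.
    dot (weight_vec k i) (weight_vec l j) = (if k = l \<and> i = j then weight_norm k i else 0)"
  unfolding all_weights dot_def sum_UNIV_3x3 sum_3
  using s_nz
  by (simp add: weight_vec_def axis_def weight_norm_def) (simp add: s[symmetric] field_simps numeral_eq_Suc)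

text \<open>A vanishing factor would make \<open>q\<close> a fourth or a third root of
  unity.\<close>

lemma weight_norm_nz: "weight_norm k i \<noteq> 0" if "i \<le> k"
proof -
  have 1: "q + inverse q \<noteq> 0"
  proof
    assume "q + inverse q = 0"
    then have "q * q + 1 = 0" using q0 by (simp add: field_simps)
    then have "q ^ 4 = 1" by algebra
    then show False using not_root by simp
  qed
  have 2: "q + 1 + inverse q \<noteq> 0"
  proof
    assume "q + 1 + inverse q = 0"
    then have "(q - 1) * (q * (q + 1 + inverse q)) = 0" by simp
    then have "q^3 = 1" using q0 by (simp add: field_simps power3_eq_cube)
    then show False using not_root by simp
  qed
  show ?thesis using 1 2 that by (auto simp: weight_norm_def nth_Cons' le_Suc_eq numeral_eq_Suc)
qed

text \<open>The sum of the rank one projectors \<open>w w\<^sup>T / (w\<^sup>T w)\<close> over an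
  orthogonal basis of one summand; the resulting matrix is visibly symmetric.\<close>

definition proj :: "nat \<Rightarrow> complex^(3 \<times> 3)^(3 \<times> 3)" where
  "proj k = (\<chi> p p'. \<Sum>i\<le>k. weight_vec k i $ p * weight_vec k i $ p' / weight_norm k i)"

lemma proj_mv: "proj k *v v = (\<Sum>i\<le>k. (dot (weight_vec k i) v / weight_norm k i) *s weight_vec k i)"
  by (simp add: proj_def dot_def matrix_vector_mult_def vec_eq_iff sum_distrib_right sum_distrib_left sum_divide_distrib mult_ac
     sum.swap[of _ UNIV])

lemma proj_weight_vec:
  assumes "k\<in>{0,2,4}" "l\<in>{0,2,4}" "j \<le> l"
  shows "proj k *v weight_vec l j = (if k = l then weight_vec l j else 0)"
proof -
  have "proj k *v weight_vec l j = (\<Sum>i\<le>k. if k = l \<and> i = j then weight_vec k i else 0)"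
    unfolding proj_mv
    using dot_weight_vec[rule_format, OF assms(1) _ assms(2,3)] weight_norm_nz by (intro sum.cong) auto
  also have "\<dots> = (if k = l then weight_vec l j else 0)"
    using assms(3) by (auto simp: if_distrib sum.If_cases)
  finally show ?thesis .
qed

text \<open>Completeness of the nine orthogonal vectors, verified entry by entry after all norms are
  written as quotients of polynomials in \<open>s\<close>.\<close>

lemma proj_sum: "(\<Sum>k\<in>{0,2,4}. proj k) = mat 1"
proof -
  have "weight_norm 4 1 \<noteq> 0" "weight_norm 0 0 \<noteq> 0" using weight_norm_nz by auto
  then have *: "q + inverse q \<noteq> 0" "q + 1 + inverse q \<noteq> 0" by (auto simp: weight_norm_def)
  have **: "q + inverse q = (s^4 + 1) / s^2" "q + 1 + inverse q = (s^4 + s^2 + 1) / s^2"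
    using s_nz by (auto simp: s[symmetric] numeral_eq_Suc field_simps)
  have nz: "s^4 + 1 \<noteq> 0" "s^4+s^2+1 \<noteq> 0" using * unfolding ** by auto
  have e: "{..4} = {0,1,2,3,4::nat}" "{..2} = {0,1,2::nat}" by auto
  show ?thesis
    unfolding vec_eq_iff split_paired_All forall_3
    by (simp add: proj_def e weight_vec_def axis_def weight_norm_def mat_def ** nz,
      simp add: nz s_nz s[symmetric] divide_simps,
      simp add: power2_eq_square power3_eq_cube power4_eq_xxxx numeral_eq_Suc algebra_simps)
qed

section \<open>Node \<open>1\<close> on the weight vectors\<close>

lemma gK0: "gK (V2 a b) 0 = (q powi (-2) \<odot> E 1 1 + E 2 2 + q ^ 2 \<odot> E 3 3) \<otimes> (q powi (-2) \<odot> E 1 1 + E 2 2 + q ^ 2 \<odot> E 3 3)"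
  and gK1: "gK (V2 a b) 1 = (q \<odot> E 1 1 + E 2 2 + inverse q \<odot> E 3 3) \<otimes> (q \<odot> E 1 1 + E 2 2 + inverse q \<odot> E 3 3)"
  by (simp_all add: tensor_def gens_L1_simps)

lemma gK1_mv:
 "(gK (V2 a b) 1 *v v) $ (1,1) = q^2 * v $ (1,1)"
 "(gK (V2 a b) 1 *v v) $ (1,2) = q * v $ (1,2)"
 "(gK (V2 a b) 1 *v v) $ (1,3) = v $ (1,3)"
 "(gK (V2 a b) 1 *v v) $ (2,1) = q * v $ (2,1)"
 "(gK (V2 a b) 1 *v v) $ (2,2) = v $ (2,2)"
 "(gK (V2 a b) 1 *v v) $ (2,3) = inverse q * v $ (2,3)"
 "(gK (V2 a b) 1 *v v) $ (3,1) = v $ (3,1)"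
 "(gK (V2 a b) 1 *v v) $ (3,2) = inverse q * v $ (3,2)"
 "(gK (V2 a b) 1 *v v) $ (3,3) = inverse q ^ 2 * v $ (3,3)"
  using q0 by (simp_all add: gK1[simplified] mv_simps power2_eq_square)

lemma gK0_mv:
 "(gK (V2 a b) 0 *v v) $ (1,1) = inverse q ^ 4 * v $ (1,1)"
 "(gK (V2 a b) 0 *v v) $ (1,2) = inverse q ^ 2 * v $ (1,2)"
 "(gK (V2 a b) 0 *v v) $ (1,3) = v $ (1,3)"
 "(gK (V2 a b) 0 *v v) $ (2,1) = inverse q ^ 2 * v $ (2,1)"
 "(gK (V2 a b) 0 *v v) $ (2,2) = v $ (2,2)"
 "(gK (V2 a b) 0 *v v) $ (2,3) = q ^ 2 * v $ (2,3)"
 "(gK (V2 a b) 0 *v v) $ (3,1) = v $ (3,1)"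
 "(gK (V2 a b) 0 *v v) $ (3,2) = q ^ 2 * v $ (3,2)"
 "(gK (V2 a b) 0 *v v) $ (3,3) = q ^ 4 * v $ (3,3)"
proof -
  have "inverse q * (inverse q * (q * q)) = 1" "q * (q * (inverse q * inverse q)) = 1"
    using q0 by (simp_all add: field_simps)
  then show "(gK (V2 a b) 0 *v v) $ (1,1) = inverse q ^ 4 * v $ (1,1)"
    "(gK (V2 a b) 0 *v v) $ (1,2) = inverse q ^ 2 * v $ (1,2)"
    "(gK (V2 a b) 0 *v v) $ (1,3) = v $ (1,3)"
    "(gK (V2 a b) 0 *v v) $ (2,1) = inverse q ^ 2 * v $ (2,1)"
    "(gK (V2 a b) 0 *v v) $ (2,2) = v $ (2,2)"
    "(gK (V2 a b) 0 *v v) $ (2,3) = q ^ 2 * v $ (2,3)"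
    "(gK (V2 a b) 0 *v v) $ (3,1) = v $ (3,1)"
    "(gK (V2 a b) 0 *v v) $ (3,2) = q ^ 2 * v $ (3,2)"
    "(gK (V2 a b) 0 *v v) $ (3,3) = q ^ 4 * v $ (3,3)"
    by (simp_all add: gK0[simplified] mv_simps power_int_minus power2_eq_square power4_eq_xxxx)
qed

text \<open>The level zero relation on the tensor product. It reduces commutation with
  \<open>K\<^sub>0\<close> to commutation with \<open>K\<^sub>1\<close>.\<close>

lemma gK0_gK1: "gK (V2 a b) 0 *v (gK (V2 a b) 1 *v (gK (V2 a b) 1 *v v)) = v"
   "gK (V2 a b) 1 *v (gK (V2 a b) 1 *v (gK (V2 a b) 0 *v v)) = v"
  using q0 unfolding vec_eq_iff_3x3 forall_3
  by (simp_all add: gK0_mv gK1_mv[simplified], simp_all add: power2_eq_square power4_eq_xxxx field_simps)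

text \<open>Node \<open>1\<close> does not see the parameters, so for it intertwining
  \<open>V2 a b\<close> with \<open>V2 b a\<close> amounts to commuting with a single
  operator.\<close>

lemma V2_node1_eq: "gE (V2 a b) 1 = gE (V2 c d) 1" "gF (V2 a b) 1 = gF (V2 c d) 1" "gK (V2 a b) 1 = gK (V2 c d) 1"
  by (simp_all only: gE1 gF1 gK1)

definition fcoef :: "nat \<Rightarrow> nat \<Rightarrow> complex" where
  "fcoef k i = (if k = 4 then r * [1, 1, q + 1 + inverse q, q + inverse q] ! i else r)"

text \<open>Since \<open>E\<^sub>1\<close> is the transpose of \<open>F\<^sub>1\<close>, these
  values are forced: \<open>ecoef k i * weight_norm k i = fcoef k i * weight_norm k (Suc
  i)\<close>.\<close>

definition ecoef :: "nat \<Rightarrow> nat \<Rightarrow> complex" where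
  "ecoef k i = (if k = 4 then r * [q + inverse q, q + 1 + inverse q, 1, 1] ! i else r)"

lemma r_nz: "r \<noteq> 0"
proof
  assume "r = 0"
  then have "s * (s + inverse s) = 0" using r by simp
  then show False using s2_plus1 s_nz by (simp add: distrib_left power2_eq_square)
qed

lemma coef_nz: "k \<in> {0,2,4} \<Longrightarrow> i < k \<Longrightarrow> fcoef k i \<noteq> 0" "k \<in> {0,2,4} \<Longrightarrow> i < k \<Longrightarrow> ecoef k i \<noteq> 0"
  \<comment> \<open>These two norms are \<open>q + inverse q\<close> and
    \<open>q + 1 + inverse q\<close>, which together with \<open>r\<close> are the only factors of
    the coefficients.\<close>
  using weight_norm_nz[of 1 4] weight_norm_nz[of 0 0] r_nz
  by (auto simp: fcoef_def ecoef_def weight_norm_def less_Suc_eq numeral_eq_Suc)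

lemma all_weights_less: "(\<forall>k\<in>{0,2,4}. \<forall>i<k. Q k i) \<longleftrightarrow> Q 4 0 \<and> Q 4 1 \<and> Q 4 2 \<and> Q 4 3 \<and>
   Q 2 0 \<and> Q 2 (1::nat)" for Q :: "nat \<Rightarrow> nat \<Rightarrow> bool"
  by (auto simp: less_Suc_eq numeral_eq_Suc)

lemma gF_weight_vec: "\<forall>k\<in>{0,2,4}. \<forall>i<k. gF (V2 a b) 1 *v weight_vec k i = fcoef k i *s weight_vec k (Suc i)"
  unfolding all_weights_less vec_eq_iff_3x3 forall_3
  by (simp add: gF1_mv[simplified] weight_vec_def fcoef_def axis_def)
    (use s_nz in \<open>simp add: s[symmetric] field_simps power2_eq_square\<close>)

lemma gE_weight_vec: "\<forall>k\<in>{0,2,4}. \<forall>i<k. gE (V2 a b) 1 *v weight_vec k (Suc i) = ecoef k i *s weight_vec k i"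
  unfolding all_weights_less vec_eq_iff_3x3 forall_3
  by (simp add: gE1_mv[simplified] weight_vec_def ecoef_def axis_def)
    (use s_nz in \<open>simp add: s[symmetric] field_simps power2_eq_square\<close>)

lemma gE_weight_vec_0: "\<forall>k\<in>{0,2,4}. gE (V2 a b) 1 *v weight_vec k 0 = 0"
  using s_nz unfolding vec_eq_iff_3x3 forall_3
  by (simp add: gE1_mv[simplified] weight_vec_def axis_def)

lemma gF_weight_vec_top: "\<forall>k\<in>{0,2,4}. gF (V2 a b) 1 *v weight_vec k k = 0"
  using s_nz unfolding vec_eq_iff_3x3 forall_3
  by (simp add: gF1_mv[simplified] weight_vec_def axis_def)

lemma gK_weight_vec: "\<forall>k\<in>{0,2,4}. \<forall>i\<le>k. gK (V2 a b) 1 *v weight_vec k i = (s powi (int k - 2 * int i)) *s weight_vec k i"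
  unfolding all_weights vec_eq_iff_3x3 forall_3
  by (simp add: gK1_mv[simplified] weight_vec_def axis_def)
    (use s_nz in \<open>simp add: s[symmetric] power_int_minus power2_eq_square power4_eq_xxxx\<close>)

section \<open>The irreducible summands and the uniqueness of the decomposition\<close>

definition summand :: "nat \<Rightarrow> (complex^(3 \<times> 3)) set" where
  "summand k = vec.span (weight_vec k ` {..k})"

lemma irreducible_summand:
  assumes k: "k \<in> {0,2,4}"
  shows "A1_irreducible s (V2 a b) k (summand k)"
  unfolding summand_def
proof (rule A1_irreducible_string[where f = "fcoef k" and e = "ecoef k" and m = "\<lambda>i. int k - 2 * int i"])
  show "weight_vec k 0 \<noteq> 0"
  proof
    assume "weight_vec k 0 = 0"
    then have "dot (weight_vec k 0) (weight_vec k 0) = 0" by (simp add: dot_def)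
    then show False using dot_weight_vec k weight_norm_nz[of 0 k] by auto
  qed
qed (simp_all only: gF_weight_vec[rule_format, OF k] gE_weight_vec[rule_format, OF k] gE_weight_vec_0[rule_format, OF k]
    gF_weight_vec_top[rule_format, OF k]
    gK_weight_vec[rule_format, OF k] coef_nz[OF k] simp_thms)

lemma summand_invariant: "k \<in> {0,2,4} \<Longrightarrow> A1_invariant (V2 a b) (summand k)"
  using irreducible_summand by (simp add: A1_irreducible_def)

lemma proj_in_summand: "proj k *v v \<in> summand k"
  unfolding proj_mv summand_def by (intro vec.span_sum vec.span_scale vec.span_base) auto

lemma eq_on_summand:
  assumes "v \<in> summand k" "\<And>i. i \<le> k \<Longrightarrow> A *v weight_vec k i = B *v weight_vec k i"
  shows "A *v v = B *v v"
  using assms(1) unfolding summand_def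
  by (induction rule: vec.span_induct_alt) (use assms(2) in \<open>auto simp: vec.add vec.scale\<close>)

lemma proj_summand:
  assumes "k\<in>{0,2,4}" "l\<in>{0,2,4}" "v \<in> summand l"
  shows "proj k *v v = (if k = l then v else 0)"
proof -
  have "proj k *v v = (if k = l then mat 1 else 0) *v v"
    by (rule eq_on_summand[OF assms(3)]) (simp add: proj_weight_vec[OF assms(1,2)])
  then show ?thesis by simp
qed

lemma proj_decomp: "(\<Sum>k\<in>{0,2,4}. proj k *v v) = v"
proof -
  have "(\<Sum>k\<in>{0,2,4}. proj k *v v) = (\<Sum>k\<in>{0,2,4}. proj k) *v v"
    by (simp add: matrix_vector_mult_add_rdistrib)
  then show ?thesis by (simp only: proj_sum matrix_vector_mul_lid)
qed

lemma matrix_eqI_summands: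
  fixes A B :: "complex^(3 \<times> 3)^'n"
  assumes "\<And>k v. k \<in> {0,2,4} \<Longrightarrow> v \<in> summand k \<Longrightarrow> A *v v = B *v v"
  shows "A = B"
proof -
  have "A *v v = B *v v" for v
  proof -
    have "A *v (\<Sum>k\<in>{0,2,4}. proj k *v v) = B *v (\<Sum>k\<in>{0,2,4}. proj k *v v)"
      unfolding vec.sum using assms proj_in_summand by (intro sum.cong) auto
    then show ?thesis unfolding proj_decomp .
  qed
  then show ?thesis by (simp add: matrix_eq)
qed

text \<open>The description in \<open>Pq\<close> leaves the decomposition open. As the three
  summands have different dimensions, \<open>A1_irreducible_eq_summand\<close> forces every
  admissible \<open>W j\<close> to be \<open>summand j\<close>, and an operator is determined by its
  action on these.\<close>

lemma Pq_eq_proj: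
  assumes k: "k \<in> {0,2,4}"
  shows "Pq q s r k = proj k"
  unfolding Pq_def
proof (rule the_equality)
  show "\<exists>W. (\<forall>j\<in>{0,2,4}. A1_irreducible s (V2 1 1) j (W j)) \<and>
       (\<forall>v. \<exists>!w. w \<in> (\<Pi>\<^sub>E j\<in>{0,2,4::nat}. W j) \<and> v = (\<Sum>j\<in>{0,2,4}. w j)) \<and>
       (\<forall>j\<in>{0,2,4}. \<forall>w\<in>W j. proj k *v w = (if j = k then w else 0))"
  proof (rule exI[of _ summand], intro conjI allI ballI)
    fix v :: "complex^(3 \<times> 3)"
    show "\<exists>!w. w \<in> (\<Pi>\<^sub>E j\<in>{0,2,4::nat}. summand j) \<and> v = (\<Sum>j\<in>{0,2,4}. w j)"
    \<comment> \<open>Members of the dependent product are \<open>undefined\<close> off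
      \<open>{0,2,4}\<close>. The witness is restricted accordingly, and uniqueness is checked
      separately on and off the index set.\<close>
    proof (rule ex1I[of _ "\<lambda>j\<in>{0,2,4}. proj j *v v"])
      show "(\<lambda>j\<in>{0,2,4}. proj j *v v) \<in> (\<Pi>\<^sub>E j\<in>{0,2,4}. summand j) \<and> v = (\<Sum>j\<in>{0,2,4}. (\<lambda>j\<in>{0,2,4}. proj j *v v) j)"
        using proj_decomp[of v] proj_in_summand by auto
      fix w assume w: "w \<in> (\<Pi>\<^sub>E j\<in>{0,2,4::nat}. summand j) \<and> v = (\<Sum>j\<in>{0,2,4}. w j)"
      show "w = (\<lambda>j\<in>{0,2,4}. proj j *v v)"
      proof
        fix j
        show "w j = (\<lambda>j\<in>{0,2,4}. proj j *v v) j"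
        proof (cases "j \<in> {0,2,4}")
          case True
          have v: "v = (\<Sum>l\<in>{0,2,4}. w l)" using w by blast
          have "proj j *v v = (\<Sum>l\<in>{0,2,4}. proj j *v w l)" unfolding v by (rule vec.sum)
          also have "\<dots> = (\<Sum>l\<in>{0,2,4}. if j = l then w l else 0)"
          proof (intro sum.cong refl)
            fix l assume l: "l \<in> {0,2,4::nat}"
            have "w l \<in> summand l" using conjunct1[OF w] l by (rule PiE_mem)
            then show "proj j *v w l = (if j = l then w l else 0)" using True l by (intro proj_summand)
          qed
          also have "\<dots> = w j" using True by (simp only: sum.delta' finite.insertI finite.emptyI if_True)
          finally show ?thesis using True by simp
        next
          case False
          then show ?thesis using PiE_arb[OF conjunct1[OF w] False] by simp
        qed
      qed
    qed
  qed (simp_all only: irreducible_summand proj_summand[OF k] eq_commute[of k])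
next
  fix P assume "\<exists>W. (\<forall>j\<in>{0,2,4}. A1_irreducible s (V2 1 1) j (W j)) \<and>
       (\<forall>v. \<exists>!w. w \<in> (\<Pi>\<^sub>E j\<in>{0,2,4::nat}. W j) \<and> v = (\<Sum>j\<in>{0,2,4}. w j)) \<and>
       (\<forall>j\<in>{0,2,4}. \<forall>w\<in>W j. P *v w = (if j = k then w else 0))"
  then obtain W where "(\<forall>j\<in>{0,2,4}. A1_irreducible s (V2 1 1) j (W j)) \<and>
       (\<forall>v. \<exists>!w. w \<in> (\<Pi>\<^sub>E j\<in>{0,2,4::nat}. W j) \<and> v = (\<Sum>j\<in>{0,2,4}. w j)) \<and>
       (\<forall>j\<in>{0,2,4}. \<forall>w\<in>W j. P *v w = (if j = k then w else 0))"
    by (rule exE)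
  from conjunct1[OF this] conjunct2[OF conjunct2[OF this]]
  have W: "\<forall>j\<in>{0,2,4}. A1_irreducible s (V2 1 1) j (W j)"
    and P: "\<forall>j\<in>{0,2,4}. \<forall>w\<in>W j. P *v w = (if j = k then w else 0)" .
  have WV: "W j = summand j" if j: "j \<in> {0,2,4}" for j
  proof (rule A1_irreducible_eq_summand[where P = proj and V = summand and J = "{0,2,4}"])
    show "A1_irreducible s (V2 1 1) j (W j)" using W j by (rule bspec)
    show "(\<Sum>k\<in>{0,2,4}. proj k) = mat 1" by (rule proj_sum)
  qed (use j in \<open>simp_all only: irreducible_summand proj_in_summand proj_summand finite.insertI finite.emptyI\<close>)
  show "P = proj k"
  proof (rule matrix_eqI_summands)
    fix j v assume j: "j \<in> {0,2,4::nat}" and v: "v \<in> summand j"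
    show "P *v v = proj k *v v"
      using P[rule_format, OF j] WV[OF j] v proj_summand[OF k j v] by (simp add: eq_commute[of k])
  qed
qed

section \<open>Intertwiners\<close>

context
  fixes z assumes z: "z \<noteq> q ^ 2" "z \<noteq> - (q ^ 3)"
begin

lemma Rmat_summand:
  assumes "k \<in> {0,2,4}" "v \<in> summand k"
  shows "Rmat q s z *v v = rho k z *s v"
proof -
  have "Rmat q s z *v v = (rho k z \<odot> mat 1) *v v"
    by (rule eq_on_summand[OF assms(2)]) (simp add: msmult_mult_vec Rmat_weight_vec[OF z, rule_format, OF assms(1)])
  then show ?thesis by (simp add: msmult_mult_vec)
qed

lemma Rmat_proj: "Rmat q s z = proj 4
              - (q powi (-2) * ((1 - q ^ 2 * z) / (1 - q powi (-2) * z))) \<odot> proj 2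
              + (q powi (-3) * ((1 + q ^ 3 * z) / (1 + q powi (-3) * z))) \<odot> proj 0" (is "_ = ?R")
proof (rule matrix_eqI_summands)
  fix k and v :: "complex^(3 \<times> 3)" assume k: "k \<in> {0,2,4}" and v: "v \<in> summand k"
  have p: "proj 4 *v v = (if 4 = k then v else 0)" "proj 2 *v v = (if 2 = k then v else 0)"
    "proj 0 *v v = (if 0 = k then v else 0)"
    using k v by (simp_all only: proj_summand insert_iff simp_thms)
  have "?R *v v = rho k z *s v"
    using k unfolding matrix_vector_mult_add_rdistrib matrix_vector_mult_diff_rdistrib msmult_mult_vec
      p rho_def by (elim insertE emptyE) simp_all
  then show "Rmat q s z *v v = ?R *v v" using Rmat_summand[OF k v] by simp
qed

text \<open>A combination of symmetric projectors is symmetric. This is what carries the relation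
  for \<open>E\<^sub>0\<close> over to \<open>F\<^sub>0\<close>.\<close>

lemma transpose_Rmat: "transpose (Rmat q s z) = Rmat q s z"
proof -
  have p: "proj k $ i $ j = proj k $ j $ i" for k i j
    by (simp add: proj_def mult.commute)
  show ?thesis
    unfolding Rmat_proj vec_eq_iff transpose_def
    by (intro allI) (simp only: vec_lambda_beta vector_add_component vector_minus_component msmult_component p)
qed

text \<open>\<open>Rmat\<close> is a scalar on each summand, so it commutes with whatever preserves
  the summands.\<close>

lemma Rmat_commutes:
  assumes "\<And>k v. k \<in> {0,2,4} \<Longrightarrow> v \<in> summand k \<Longrightarrow> A *v v \<in> summand k"
  shows "Rmat q s z ** A = A ** Rmat q s z"
  by (rule matrix_eqI_summands) (simp only: matrix_vector_mul_assoc[symmetric] assms Rmat_summand vec.scale)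

lemma Rmat_node1:
  "Rmat q s z ** gE (V2 a b) 1 = gE (V2 b a) 1 ** Rmat q s z"
  "Rmat q s z ** gF (V2 a b) 1 = gF (V2 b a) 1 ** Rmat q s z"
  "Rmat q s z ** gK (V2 a b) 1 = gK (V2 b a) 1 ** Rmat q s z"
proof -
  have inv: "gE (V2 a b) 1 *v v \<in> summand k" "gF (V2 a b) 1 *v v \<in> summand k" "gK (V2 a b) 1 *v v \<in> summand k"
    if "k \<in> {0,2,4}" "v \<in> summand k" for k v
    using summand_invariant[OF that(1), of a b] that(2) by (simp_all add: A1_invariant_def)
  show "Rmat q s z ** gE (V2 a b) 1 = gE (V2 b a) 1 ** Rmat q s z"
    "Rmat q s z ** gF (V2 a b) 1 = gF (V2 b a) 1 ** Rmat q s z"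
    "Rmat q s z ** gK (V2 a b) 1 = gK (V2 b a) 1 ** Rmat q s z"
    unfolding V2_node1_eq[of b a a b] by (rule Rmat_commutes, rule inv, assumption+)+
qed

lemma Rmat_K0: "Rmat q s z ** gK (V2 a b) 0 = gK (V2 b a) 0 ** Rmat q s z"
proof -
  have K0: "gK (V2 b a) 0 = gK (V2 a b) 0" by (simp only: gK0)
  have K1: "Rmat q s z *v (gK (V2 a b) 1 *v v) = gK (V2 a b) 1 *v (Rmat q s z *v v)" for v
    using Rmat_node1(3)[of a b] unfolding matrix_vector_mul_assoc V2_node1_eq(3)[of b a a b] by simp
  have "Rmat q s z *v (gK (V2 a b) 0 *v v) = gK (V2 b a) 0 *v (Rmat q s z *v v)" for v
  proof -
    let ?w = "gK (V2 a b) 0 *v v"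
    \<comment> \<open>Insert \<open>K\<^sub>1\<^sup>2 K\<^sub>0 = 1\<close>, move both factors
      \<open>K\<^sub>1\<close> past \<open>Rmat\<close>, and cancel them by applying
      \<open>K\<^sub>0\<close>.\<close>
    have "Rmat q s z *v v = Rmat q s z *v (gK (V2 a b) 1 *v (gK (V2 a b) 1 *v ?w))"
      by (simp only: gK0_gK1(2))
    also have "\<dots> = gK (V2 a b) 1 *v (gK (V2 a b) 1 *v (Rmat q s z *v ?w))"
      by (simp only: K1)
    finally show ?thesis by (simp only: K0 gK0_gK1(1))
  qed
  then show ?thesis by (simp add: matrix_eq flip: matrix_vector_mul_assoc)
qed

end

section \<open>Node \<open>0\<close> and the intertwining property\<close>

lemma transpose_gE0:
  assumes "a \<noteq> 0" "b \<noteq> 0"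
  shows "transpose (gE (V2 (inverse a) (inverse b)) 0) = gF (V2 a b) 0"
  unfolding gE0 gF0[OF assms] by (simp only: transpose_add transpose_msmult transpose_kron transpose_E)

lemma Rmat_hom:
  assumes ab: "a \<noteq> 0" "b \<noteq> 0" and z: "a / b \<noteq> q ^ 2" "a / b \<noteq> - (q ^ 3)"
  shows "uq_hom (V2 a b) (V2 b a) (Rmat q s (a / b))"
proof -
  have E0: "Rmat q s (c / d) ** gE (V2 c d) 0 = gE (V2 d c) 0 ** Rmat q s (c / d)"
    if "d \<noteq> 0" "c / d \<noteq> q ^ 2" "c / d \<noteq> - (q ^ 3)" for c d
    by (simp only: matrix_eq matrix_vector_mul_assoc[symmetric] Rmat_gE0[OF that] simp_thms)
  \<comment> \<open>Inverting and exchanging the parameters preserves their ratio, so the same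
    \<open>Rmat\<close> occurs in both relations.\<close>
  have eq: "inverse b / inverse a = a / b" using ab by (simp add: divide_simps)
  have "Rmat q s (a / b) ** gE (V2 (inverse b) (inverse a)) 0 =
      gE (V2 (inverse a) (inverse b)) 0 ** Rmat q s (a / b)"
    using E0[of "inverse a" "inverse b"] z ab unfolding eq by simp
  \<comment> \<open>Transposition reverses products: the \<open>E\<^sub>0\<close> relation from
    \<open>(1/b, 1/a)\<close> to \<open>(1/a, 1/b)\<close> becomes the \<open>F\<^sub>0\<close>
    relation from \<open>(a, b)\<close> to \<open>(b, a)\<close>.\<close>
  then have "transpose (gE (V2 (inverse b) (inverse a)) 0) ** Rmat q s (a / b) =
      Rmat q s (a / b) ** transpose (gE (V2 (inverse a) (inverse b)) 0)"
    by (metis matrix_transpose_mul transpose_Rmat[OF z])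
  then have F0: "Rmat q s (a / b) ** gF (V2 a b) 0 = gF (V2 b a) 0 ** Rmat q s (a / b)"
    by (simp only: transpose_gE0[OF ab] transpose_gE0[OF ab(2,1)])
  show ?thesis
    unfolding uq_hom_def by (simp only: ball_simps E0[OF ab(2) z] F0 Rmat_node1[OF z, of a b] Rmat_K0[OF z, of a b] simp_thms)
qed

text \<open>The coefficients are pairings with the weight vectors divided by norms. For
  \<open>b \<noteq> 0\<close>, those along \<open>weight_vec 2 1\<close> and
  \<open>weight_vec 0 0\<close> vanish exactly at \<open>a / b = q ^ 2\<close> and at
  \<open>a / b = - (q ^ 3)\<close>.\<close>

lemma gE0_weight_vec: "gE (V2 a b) 0 *v weight_vec 4 0 =
    ((a + b) / weight_norm 4 2) *s weight_vec 4 2 + ((a / q - b * q) / weight_norm 2 1) *s weight_vec 2 1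
    + ((a / (s * q) + s * b * q) / weight_norm 0 0) *s weight_vec 0 0"
proof -
  have e: "{..4} = {0,1,2,3,4::nat}" "{..2} = {0,1,2::nat}" by auto
  let ?v = "gE (V2 a b) 0 *v weight_vec 4 0"
  have d: "dot (weight_vec k i) ?v = b * q * weight_vec k i $ (1,3) + a * inverse q * weight_vec k i $ (3,1)"
    for k i
    unfolding dot_def sum_UNIV_3x3 sum_3 by (simp add: gE0_mv) (simp add: weight_vec_def axis_def)
  have c: "dot (weight_vec 4 0) ?v = 0" "dot (weight_vec 4 1) ?v = 0" "dot (weight_vec 4 2) ?v = a + b"
    "dot (weight_vec 4 3) ?v = 0"
    "dot (weight_vec 4 4) ?v = 0" "dot (weight_vec 2 0) ?v = 0" "dot (weight_vec 2 1) ?v = a / q - b * q"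
    "dot (weight_vec 2 2) ?v = 0"
    "dot (weight_vec 0 0) ?v = a / (s * q) + s * b * q"
    unfolding d using q0 s_nz by (simp_all add: weight_vec_def axis_def divide_simps)
  have "?v = (\<Sum>k\<in>{0,2,4}. \<Sum>i\<le>k. (dot (weight_vec k i) ?v / weight_norm k i) *s weight_vec k i)"
    using proj_decomp[of ?v] unfolding proj_mv by (rule sym)
  also have "\<dots> = ((a + b) / weight_norm 4 2) *s weight_vec 4 2 + ((a / q - b * q) / weight_norm 2 1) *s weight_vec 2 1
    + ((a / (s * q) + s * b * q) / weight_norm 0 0) *s weight_vec 0 0"
    by (simp add: e c c[simplified])
  finally show ?thesis .
qed

lemma hom_unique:
  assumes ab: "a \<noteq> 0" "b \<noteq> 0" and z: "a / b \<noteq> q ^ 2" "a / b \<noteq> - (q ^ 3)"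
    and T: "uq_hom (V2 a b) M T" and T': "uq_hom (V2 a b) M T'" and eq: "T *v weight_vec 4 0 = T' *v weight_vec 4 0"
  shows "T = T'"
proof -
  \<comment> \<open>The equalizer of two homomorphisms is a subspace stable under all
    \<open>E\<^sub>i\<close> and \<open>F\<^sub>i\<close>; the aim is to find all nine weight
    vectors in it.\<close>
  define N where "N = {v. T *v v = T' *v v}"
  have subN: "vec.subspace N" by (simp add: vec.subspace_def N_def vec.add vec.scale)
  have cancel: "x \<in> N" if "c *s x \<in> N" "c \<noteq> 0" for c x
    using vec.subspace_scale[OF subN that(1), of "inverse c"] that(2) by simp
  have "T *v (gE (V2 a b) i *v v) = gE M i *v (T *v v)" "T *v (gF (V2 a b) i *v v) = gF M i *v (T *v v)"
    "T' *v (gE (V2 a b) i *v v) = gE M i *v (T' *v v)" "T' *v (gF (V2 a b) i *v v) = gF M i *v (T' *v v)"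
    if "i \<in> {0,1}" for i v
    using T T' that unfolding uq_hom_def matrix_vector_mul_assoc by auto
  then have EN: "gE (V2 a b) i *v v \<in> N" and FN: "gF (V2 a b) i *v v \<in> N" if "i \<in> {0,1}" "v \<in> N" for i v
    using that by (auto simp: N_def)
  have string: "weight_vec k i \<in> N" if k: "k \<in> {0,2,4}" and "weight_vec k 0 \<in> N" "i \<le> k" for k i
    using that(3)
  proof (induction i)
    case (Suc i)
    then have "fcoef k i *s weight_vec k (Suc i) \<in> N" using FN[of 1 "weight_vec k i"] gF_weight_vec k by auto
    then show ?case using cancel coef_nz(1)[OF k, of i] Suc.prems by auto
  qed (use that in simp)
  have "weight_vec 4 0 \<in> N" using eq by (simp add: N_def)
  then have N4: "weight_vec 4 i \<in> N" if "i \<le> 4" for i using string[of 4 i] that by simp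
  let ?\<beta> = "(a / q - b * q) / weight_norm 2 1" and ?\<gamma> = "(a / (s * q) + s * b * q) / weight_norm 0 0"
  have "?\<beta> \<noteq> 0"
    using z(1) ab q0 weight_norm_nz[of 1 2] by (auto simp: field_simps power2_eq_square)
  have "?\<gamma> \<noteq> 0"
    using z(2) ab q0 s_nz weight_norm_nz[of 0 0] by (auto simp: s[symmetric] add_eq_0_iff field_simps numeral_eq_Suc)
  have "gE (V2 a b) 0 *v weight_vec 4 0 - ((a + b) / weight_norm 4 2) *s weight_vec 4 2 \<in> N"
    using N4 by (intro vec.subspace_diff[OF subN] vec.subspace_scale[OF subN] EN) auto
  then have bc: "?\<beta> *s weight_vec 2 1 + ?\<gamma> *s weight_vec 0 0 \<in> N" by (simp add: gE0_weight_vec)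
  \<comment> \<open>\<open>E\<^sub>1\<close> kills the vector \<open>weight_vec 0 0\<close> of the
    trivial summand. Applied to the mixed combination in \<open>bc\<close>, it isolates a multiple
    of \<open>weight_vec 2 0\<close>.\<close>
  have "gE (V2 a b) 1 *v weight_vec 2 1 = ecoef 2 0 *s weight_vec 2 0" using gE_weight_vec[rule_format, of 2 0] by simp
  then have "gE (V2 a b) 1 *v (?\<beta> *s weight_vec 2 1 + ?\<gamma> *s weight_vec 0 0) = (?\<beta> * ecoef 2 0) *s weight_vec 2 0"
    using gE_weight_vec_0 by (simp add: vec.add vec.scale del: One_nat_def)
  then have "weight_vec 2 0 \<in> N"
    using cancel EN[OF _ bc, of 1] \<open>?\<beta> \<noteq> 0\<close> coef_nz(2)[of 2 0] by auto
  then have N2: "weight_vec 2 i \<in> N" if "i \<le> 2" for i using string[of 2 i] that by simp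
  have "?\<gamma> *s weight_vec 0 0 \<in> N"
    using vec.subspace_diff[OF subN bc vec.subspace_scale[OF subN N2[of 1]], of ?\<beta>] by simp
  then have "weight_vec 0 0 \<in> N" using cancel \<open>?\<gamma> \<noteq> 0\<close> by blast
  then have mem: "T *v weight_vec k i = T' *v weight_vec k i" if "k \<in> {0,2,4}" "i \<le> k" for k i
    using that N4 N2 by (auto simp: N_def)
  show ?thesis
  proof (rule matrix_eqI_summands)
    fix k v assume k: "k \<in> {0,2,4}" and v: "v \<in> summand k"
    show "T *v v = T' *v v" by (rule eq_on_summand[OF v mem[OF k]])
  qed
qed

lemma vtensor_weight_vec: "vtensor (bv 1) (bv 1) = weight_vec 4 0"
  by (simp add: vec_eq_iff_3x3 forall_3 vtensor_def bv_def weight_vec_def axis_def)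

lemma hom_iff_Rmat:
  assumes ab: "a \<noteq> 0" "b \<noteq> 0" and z: "a / b \<notin> {q ^ 2, - (q ^ 3)}"
  shows "uq_hom (V2 a b) (V2 b a) T \<and> T *v vtensor (bv 1) (bv 1) = vtensor (bv 1) (bv 1) \<longleftrightarrow> T = Rmat q s (a / b)"
proof -
  have z': "a / b \<noteq> q ^ 2" "a / b \<noteq> - (q ^ 3)" using z by auto
  have "Rmat q s (a / b) *v weight_vec 4 0 = weight_vec 4 0" using Rmat_weight_vec[OF z'] by (simp add: rho_def)
  then show ?thesis unfolding vtensor_weight_vec using Rmat_hom[OF ab z'] hom_unique[OF ab z'] by metis
qed

section \<open>The normalized R-matrix\<close>

definition Rden :: "complex poly" where
  "Rden = [:1, - (q powi (-2)):] * [:1, q powi (-3):]"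

text \<open>The projector formula multiplied by \<open>Rden\<close>: the numerator of each
  nontrivial eigenvalue is paired with the factor of \<open>Rden\<close> missing from its own
  denominator.\<close>

definition Rnum :: "complex poly^(3 \<times> 3)^(3 \<times> 3)" where
  "Rnum = (\<chi> i j. smult (proj 4 $ i $ j) Rden
     - smult (q powi (-2) * proj 2 $ i $ j) ([:1, - (q ^ 2):] * [:1, q powi (-3):])
     + smult (q powi (-3) * proj 0 $ i $ j) ([:1, q ^ 3:] * [:1, - (q powi (-2)):]))"

lemma poly_Rden: "poly Rden z = (1 - q powi (-2) * z) * (1 + q powi (-3) * z)"
  by (simp add: Rden_def algebra_simps)

lemma Rden_eq_0: "poly Rden z = 0 \<longleftrightarrow> z \<in> {q ^ 2, - (q ^ 3)}"
proof -
  have "1 - q powi (-2) * z = (q ^ 2 - z) / q ^ 2" "1 + q powi (-3) * z = (q ^ 3 + z) / q ^ 3"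
    using q0 by (simp_all add: power_int_minus field_simps)
  then show ?thesis unfolding poly_Rden using q0 by (auto simp: add_eq_0_iff2)
qed

lemma Rmat_rational:
  assumes "poly Rden z \<noteq> 0"
  shows "Rmat q s z = (\<chi> i j. poly (Rnum $ i $ j) z / poly Rden z)"
proof -
  have z: "z \<noteq> q ^ 2" "z \<noteq> - (q ^ 3)" using assms by (auto simp: Rden_eq_0)
  have "1 - q powi (-2) * z \<noteq> 0" "1 + q powi (-3) * z \<noteq> 0"
    using assms unfolding poly_Rden by auto
  then show ?thesis
    unfolding Rmat_proj[OF z]
    by (simp add: vec_eq_iff msmult_component Rnum_def poly_Rden mult.commute[of z] divide_simps)
       (simp add: algebra_simps)
qed

text \<open>Both poles are genuine. At a zero of \<open>Rden\<close> the \<open>proj 4\<close> term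
  drops out, so a vanishing numerator would equate multiples of \<open>proj 0\<close> and
  \<open>proj 2\<close>; testing on weight vectors makes both factors zero. But \<open>?c2\<close>
  is nonzero at \<open>q ^ 2\<close> and \<open>?c0\<close> at \<open>- (q ^ 3)\<close>, because
  \<open>q ^ 4 \<noteq> 1\<close>, \<open>q ^ 6 \<noteq> 1\<close> and
  \<open>q \<noteq> -1\<close>.\<close>

lemma Rnum_pole:
  assumes "poly Rden z = 0"
  shows "\<exists>i j. poly (Rnum $ i $ j) z \<noteq> 0"
proof (rule ccontr)
  assume *: "\<not> ?thesis"
  let ?c2 = "q powi (-2) * ((1 - q ^ 2 * z) * (1 + q powi (-3) * z))"
  let ?c0 = "q powi (-3) * ((1 + q ^ 3 * z) * (1 - q powi (-2) * z))"
  have "q ^ 2 \<noteq> 1" using not_root by simp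
  then have "q \<noteq> -1" by auto
  have "?c0 \<odot> proj 0 = ?c2 \<odot> proj 2"
    using * assms by (simp add: vec_eq_iff Rnum_def msmult_component algebra_simps)
  then have eq: "(?c0 \<odot> proj 0) *v v = (?c2 \<odot> proj 2) *v v" for v by simp
  have nz: "weight_vec 0 0 \<noteq> 0" "weight_vec 2 0 \<noteq> 0"
    using s_nz by (auto simp: vec_eq_iff_3x3 forall_3 weight_vec_def axis_def)
  have "?c0 = 0"
    using eq[of "weight_vec 0 0"] proj_weight_vec[of 0 0 0] proj_weight_vec[of 2 0 0] nz by (simp add: msmult_mult_vec)
  moreover have "?c2 = 0"
    using eq[of "weight_vec 2 0"] proj_weight_vec[of 0 2 0] proj_weight_vec[of 2 2 0] nz by (simp add: msmult_mult_vec)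
  moreover have "?c2 \<noteq> 0" if "z = q ^ 2"
  proof -
    have "?c2 = (1 - q ^ 4) * (q + 1) / q ^ 3"
      using q0 unfolding that by (simp add: power_int_minus divide_simps) (simp add: numeral_eq_Suc algebra_simps)
    then show ?thesis using q0 \<open>q \<noteq> -1\<close> not_root by (auto simp: add_eq_0_iff2)
  qed
  moreover have "?c0 \<noteq> 0" if "z = - (q ^ 3)"
  proof -
    have "?c0 = (1 - q ^ 6) * (q + 1) / q ^ 3"
      using q0 unfolding that by (simp add: power_int_minus divide_simps) (simp add: numeral_eq_Suc algebra_simps)
    then show ?thesis using q0 \<open>q \<noteq> -1\<close> not_root by (auto simp: add_eq_0_iff2)
  qed
  ultimately show False
    using assms by (auto simp only: Rden_eq_0)
qed

lemma rational_op_Rmat: "rational_op (Rmat q s)"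
  unfolding rational_op_def
proof (intro exI[of _ Rnum] exI[of _ Rden] conjI allI impI)
  show "Rden \<noteq> 0" by (simp add: Rden_def)
qed (erule Rnum_pole Rmat_rational)+

lemma normalized_R_Rmat: "normalized_R q s r (Rmat q s)"
  unfolding normalized_R_def
  by (intro conjI rational_op_Rmat exI[of _ "{q ^ 2, - (q ^ 3)}"] allI impI hom_iff_Rmat) auto

lemma normalized_R_eq_Rmat:
  assumes R: "normalized_R q s r R" and z: "z \<noteq> q ^ 2" "z \<noteq> - (q ^ 3)"
  shows "R z = Rmat q s z"
proof -
  from R obtain S where S: "finite S" and
    hom: "\<forall>a b. a \<noteq> 0 \<longrightarrow> b \<noteq> 0 \<longrightarrow> a / b \<notin> S \<longrightarrow> (\<forall>T.
      uq_hom (V2 a b) (V2 b a) T \<and> T *v vtensor (bv 1) (bv 1) = vtensor (bv 1) (bv 1) \<longleftrightarrow> T = R (a / b))"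
    unfolding normalized_R_def by (elim conjE exE)
  \<comment> \<open>The parameters are taken as \<open>a = x\<close>, \<open>b = 1\<close>. Since
    \<open>a\<close> must be nonzero, \<open>0\<close> joins the exceptional set.\<close>
  have *: "R x = Rmat q s x" if "x \<notin> insert 0 S" "poly Rden x \<noteq> 0" for x
  proof -
    have x: "x \<noteq> 0" "x / 1 \<notin> S" "x / 1 \<notin> {q ^ 2, - (q ^ 3)}" using that by (auto simp: Rden_eq_0)
    \<comment> \<open>Read backwards with \<open>T = R (x / 1)\<close>, the characterization says
      that \<open>R (x / 1)\<close> is itself a normalized intertwiner, to which uniqueness
      applies.\<close>
    from hom[rule_format, OF x(1) one_neq_zero x(2), THEN iffD2, OF refl]
    have "R (x / 1) = Rmat q s (x / 1)"
      by (rule hom_iff_Rmat[OF x(1) one_neq_zero x(3), THEN iffD1])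
    then show ?thesis by simp
  qed
  have **: "R x = (\<chi> i j. poly (Rnum $ i $ j) x / poly Rden x)"
    if "x \<notin> insert 0 S" "poly Rden x \<noteq> 0" for x
    using *[OF that] Rmat_rational[OF that(2)] by (rule trans)
  have Rz: "poly Rden z \<noteq> 0" using z by (simp add: Rden_eq_0)
  have "rational_op R" using R by (simp only: normalized_R_def)
  \<comment> \<open>Rationality extends the equality to \<open>z = 0\<close> and to the points of
    \<open>S\<close> that are not zeros of \<open>Rden\<close>.\<close>
  then have "R z = (\<chi> i j. poly (Rnum $ i $ j) z / poly Rden z)"
    by (rule rational_op_eq[OF _ Rz finite.insertI[OF S] **])
  then show ?thesis by (simp only: Rmat_rational[OF Rz])
qed

end

theorem theorem3p4:
  fixes q s r :: complex
  assumes "q \<noteq> 0"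
    and "\<forall>n>0. q ^ n \<noteq> 1"
    and "s ^ 2 = q"
    and "r ^ 2 = s + inverse s"
  shows "(\<exists>R. normalized_R q s r R) \<and>
    (\<forall>R. normalized_R q s r R \<longrightarrow>
      (\<forall>z. z \<noteq> q ^ 2 \<longrightarrow> z \<noteq> - (q ^ 3) \<longrightarrow>
        R z = Pq q s r 4
              - (q powi (-2) * ((1 - q ^ 2 * z) / (1 - q powi (-2) * z))) \<odot> Pq q s r 2
              + (q powi (-3) * ((1 + q ^ 3 * z) / (1 + q powi (-3) * z))) \<odot> Pq q s r 0 \<and>
        R z = R_sl3 q z
              + ((q - inverse q) * (1 - z) /
                  ((q - inverse q * z) * (s ^ 3 + s powi (-3) * z))) \<odot> Qmat q s z))"
proof -
  interpret quantum_parameters q s r by unfold_locales fact+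
  have P: "Pq q s r 4 = proj 4" "Pq q s r 2 = proj 2" "Pq q s r 0 = proj 0"
    by (simp_all add: Pq_eq_proj)
  show ?thesis
    unfolding P
  proof (intro conjI allI impI)
    show "\<exists>R. normalized_R q s r R" by (rule exI[of _ "Rmat q s"]) (rule normalized_R_Rmat)
    fix R z assume "normalized_R q s r R" and z: "z \<noteq> q ^ 2" "z \<noteq> - (q ^ 3)"
    then have "R z = Rmat q s z" by (rule normalized_R_eq_Rmat)
    then show "R z = proj 4
              - (q powi (-2) * ((1 - q ^ 2 * z) / (1 - q powi (-2) * z))) \<odot> proj 2
              + (q powi (-3) * ((1 + q ^ 3 * z) / (1 + q powi (-3) * z))) \<odot> proj 0"
      "R z = R_sl3 q z + ((q - inverse q) * (1 - z) /
                  ((q - inverse q * z) * (s ^ 3 + s powi (-3) * z))) \<odot> Qmat q s z"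
      using Rmat_proj[OF z] by (simp_all only: Rmat_def)
  qed
qed

end
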